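(* For any $a,b\in\{0,1\}$ and $X\in\{F,G,H\}$, the intersection polynomial $X_{ab}(K;t)$ of long virtual knots $K$ is not a finite-type invariant under virtualizations.
   Context: A long virtual knot diagram is an immersed line in $\mathbb{R}^2$ that agrees with the $x$-axis outside some $2$-disk and has finitely many transversal double points, each being either a real crossing (with over/under information) or a virtual crossing (without it); it is oriented from $-\infty$ to $\infty$. A long virtual knot is an equivalence class of such diagrams under generalized Reidemeister moves (the classical moves I, II, III on real crossings, the three analogous moves on virtual crossings, and the mixed move passing a strand having only virtual crossings across a real crossing). Let $D$ be a diagram of a long virtual knot $K$ with real crossings $c_1,\dots,c_n$, and let $\varepsilon_i\in\{1,-1\}$ be the sign of $c_i$. The crossing $c_i$ is of type $0$ if, travelling along $D$ from $-\infty$ to $\infty$, one passes $c_i$ first over and then under; otherwise it is of type $1$. For $a\in\{0,1\}$ put $I_a=\{i\mid c_i\text{ is of type }a\}$ and $\omega_a=\sum_{i\in I_a}\varepsilon_i$. A surface realization of $D$ is a closed, connected, oriented surface $\Sigma_g$ together with an oriented knot diagram on $\Sigma_g$ with a basepoint and with no virtual crossings, whose real crossings coincide with those of $D$ (same order of passage, over/under information and signs), and whose basepoint corresponds to $\pm\infty$ of $D$. Smoothing this diagram at $c_i$ (respecting orientation) gives two oriented loops on $\Sigma_g$: $\alpha_i$ is the one not containing the basepoint and $\beta_i$ is the one containing it; they are regarded as homology cycles on $\Sigma_g$. The intersection numbers $\gamma\cdot\gamma'\in\mathbb{Z}$ of such cycles are independent of the choice of surface realization. Put $W_a(K;t)=\sum_{i\in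 I_a}\varepsilon_i(t^{\alpha_i\cdot\beta_i}-1)$ and \[F_{ab}(K;t)=\sum_{i\in I_a,\,j\in I_b}\varepsilon_i\varepsilon_j(t^{\alpha_i\cdot\alpha_j}-1),\] \[G_{ab}(K;t)=\sum_{i\in I_a,\,j\in I_b}\varepsilon_i\varepsilon_j(t^{\alpha_i\cdot\beta_j}-1)-\omega_bW_a(K;t),\] \[H_{ab}(K;t)=\sum_{i\in I_a,\,j\in I_b}\varepsilon_i\varepsilon_j(t^{\beta_i\cdot\beta_j}-1)-\omega_aW_b(K;t)-\omega_bW_a(K;t^{-1}).\] These Laurent polynomials in $\mathbb{Z}[t,t^{-1}]$ (the intersection polynomials of $K$) depend only on $K$, not on $D$. An $n$-marked long virtual knot diagram $(D,C_n)$ is a diagram $D$ with a set $C_n=\{c_1,\dots,c_n\}$ of $n$ specified real crossings of $D$. For $\delta_1,\dots,\delta_n\in\{0,1\}$, $D_{\delta_1,\dots,\delta_n}$ is the diagram obtained from $D$ by a virtualization (replacing the real crossing by a virtual crossing) at each $c_i\in C_n$ with $\delta_i=1$ and leaving $c_i$ unchanged if $\delta_i=0$; $K_{\delta_1,\dots,\delta_n}$ is the long virtual knot it presents. An invariant $v$ of long virtual knots with values in an abelian group is not a finite-type invariant under virtualizations if and only if there exist infinitely many integers $n\ge0$ such that there is an $n$-marked diagram $(D,C_n)$ with \[\sum_{\delta_1,\dots,\delta_n\in\{0,1\}}(-1)^{\delta_1+\dots+\delta_n}v(K_{\delta_1,\dots,\delta_n})\neq0.\] *)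

theory Defs
  imports
    Main
    "HOL-Library.Poly_Mapping"
    "HOL-Combinatorics.Orbits"
begin

section \<open>Curves on closed oriented surfaces\<close>

text \<open>
  A generic immersed oriented closed curve with a basepoint on a closed connected oriented surface,
  all of whose complementary regions are discs, is recorded up to orientation-preserving
  homeomorphism by a word \<open>w\<close>, which lists the double points in the order of passage from the
  basepoint (so that each occurs twice), and a function \<open>r\<close>: \<open>r c = 1\<close> if the tangent vectors of the
  first and the second passage through \<open>c\<close> form, in this order, a positive basis of the tangent
  plane, and \<open>r c = -1\<close> otherwise.

  The curve is a graph whose vertices are the double points and the basepoint (of valency 2).
  Its edges are numbered \<open>0, \<dots>, length w\<close>: edge \<open>k\<close> ends at the passage \<open>w ! k\<close> and edge \<open>k + 1\<close>
  starts there; edge \<open>0\<close> starts and edge \<open>length w\<close> ends at the basepoint.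
  A dart \<open>(k, True)\<close> is the edge \<open>k\<close> traversed along the curve, \<open>(k, False)\<close> its reverse.
\<close>

definition first_pos :: "nat list \<Rightarrow> nat \<Rightarrow> nat" where
  "first_pos w c = (LEAST i. i < length w \<and> w ! i = c)"

definition second_pos :: "nat list \<Rightarrow> nat \<Rightarrow> nat" where
  "second_pos w c = (GREATEST i. i < length w \<and> w ! i = c)"

definition other_pos :: "nat list \<Rightarrow> nat \<Rightarrow> nat" where
  "other_pos w i = (if i = first_pos w (w ! i) then second_pos w (w ! i) else first_pos w (w ! i))"

text \<open>
  \<open>crossing_dir w r i = 1\<close> iff (tangent of passage \<open>i\<close>, tangent of the other passage) is a positive
  basis, that is, the other strand crosses passage \<open>i\<close> from right to left.
\<close>

definition crossing_dir :: "nat list \<Rightarrow> (nat \<Rightarrow> int) \<Rightarrow> nat \<Rightarrow> int" where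
  "crossing_dir w r i = (if i = first_pos w (w ! i) then r (w ! i) else - r (w ! i))"

text \<open>
  The boundary of the region to the left of a dart is traversed by turning left at every double point.
\<close>

fun next_dart :: "nat list \<Rightarrow> (nat \<Rightarrow> int) \<Rightarrow> nat \<times> bool \<Rightarrow> nat \<times> bool" where
  "next_dart w r (k, True) =
     (if k = length w then (0, True)
      else if crossing_dir w r k = 1 then (other_pos w k + 1, True)
      else (other_pos w k, False))"
| "next_dart w r (k, False) =
     (if k = 0 then (length w, False)
      else if crossing_dir w r (k - 1) = - 1 then (other_pos w (k - 1) + 1, True)
      else (other_pos w (k - 1), False))"

definition faces :: "nat list \<Rightarrow> (nat \<Rightarrow> int) \<Rightarrow> (nat \<times> bool) set set" where
  "faces w r = orbit (next_dart w r) ` ({0..length w} \<times> UNIV)"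

definition euler_char :: "nat list \<Rightarrow> (nat \<Rightarrow> int) \<Rightarrow> int" where
  "euler_char w r = int (card (set w) + 1) - int (length w + 1) + int (card (faces w r))"

text \<open>
  A 1-chain assigns an integer to every edge. The half-edges at the double point \<open>c\<close> are
  listed in counterclockwise order, starting with the outgoing one of the first passage.
\<close>

definition outflow :: "nat list \<Rightarrow> (nat \<Rightarrow> int) \<Rightarrow> nat \<Rightarrow> (nat \<Rightarrow> int) \<Rightarrow> int list" where
  "outflow w r c x =
     (let p = first_pos w c; q = second_pos w c in
      if r c = 1 then [x (p + 1), x (q + 1), - x p, - x q]
      else [x (p + 1), - x q, - x p, x (q + 1)])"

text \<open>
  Intersection number of two 1-cycles: pushing \<open>y\<close> off the graph to its left or to its right makes
  the cycles transverse. Averaging the contributions of both push-offs near a double point gives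
  half of the antisymmetric sum below, which for transverse \<open>x\<close>, \<open>y\<close> is \<open>1\<close> if their tangents form a
  positive basis and \<open>-1\<close> otherwise. At the basepoint the contribution vanishes. The total is
  always even before the division by 2.
\<close>

definition intersection_number ::
  "nat list \<Rightarrow> (nat \<Rightarrow> int) \<Rightarrow> (nat \<Rightarrow> int) \<Rightarrow> (nat \<Rightarrow> int) \<Rightarrow> int" where
  "intersection_number w r x y =
     (\<Sum>c\<in>set w. \<Sum>j<4. \<Sum>i<j.
        outflow w r c x ! i * outflow w r c y ! j - outflow w r c x ! j * outflow w r c y ! i) div 2"


section \<open>Long virtual knot diagrams\<close>

text \<open>
  The one-point compactification of the plane turns an immersed line into a closed curve on the
  sphere with basepoint \<open>\<infinity>\<close>; a connected curve on the sphere is determined by \<open>(w, r)\<close> up to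
  isotopy. So long virtual knot diagrams up to planar isotopy are the codes of Euler characteristic 2,
  together with the crossing information.
\<close>

datatype crossing_kind = Virtual | First_Over | First_Under

typedef long_diagram =
  "{(w, r, \<kappa>). (\<forall>c\<in>set w. count_list w c = 2 \<and> r c \<in> {1, - 1}) \<and> euler_char w r = 2}
   :: (nat list \<times> (nat \<Rightarrow> int) \<times> (nat \<Rightarrow> crossing_kind)) set"
proof -
  have "orbit (next_dart [] r) (0, b) = {(0, b)}" for r b
  proof -
    have fp: "next_dart [] r (0, b) = (0, b)" by (cases b) auto
    have "y = (0, b)" if "y \<in> orbit (next_dart [] r) (0, b)" for y
      using that by induction (use fp in auto)
    moreover have "(0, b) \<in> orbit (next_dart [] r) (0, b)"
      using orbit.base[of "next_dart [] r" "(0, b)"] fp by simp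
    ultimately show ?thesis by blast
  qed
  then have "faces [] (\<lambda>_. 1) = {{(0, True)}, {(0, False)}}"
    by (auto simp: faces_def image_def UNIV_bool)
  then have "euler_char [] (\<lambda>_. 1) = 2"
    by (simp add: euler_char_def)
  then show ?thesis
    by (intro exI[of _ "([], \<lambda>_. 1, \<lambda>_. Virtual)"]) simp
qed

setup_lifting type_definition_long_diagram

lift_definition word :: "long_diagram \<Rightarrow> nat list" is "\<lambda>(w, r, \<kappa>). w" .

lift_definition rot :: "long_diagram \<Rightarrow> nat \<Rightarrow> int" is "\<lambda>(w, r, \<kappa>). r" .

lift_definition kind :: "long_diagram \<Rightarrow> nat \<Rightarrow> crossing_kind" is "\<lambda>(w, r, \<kappa>). \<kappa>" .

lift_definition virtualize :: "nat set \<Rightarrow> long_diagram \<Rightarrow> long_diagram"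
  is "\<lambda>C (w, r, \<kappa>). (w, r, \<lambda>c. if c \<in> C then Virtual else \<kappa> c)"
  by auto

definition real_crossings :: "long_diagram \<Rightarrow> nat set" where
  "real_crossings D = {c \<in> set (word D). kind D c \<noteq> Virtual}"

text \<open>Positive crossings: (tangent of the over-strand, tangent of the under-strand) is a positive basis.\<close>

definition crossing_sign :: "long_diagram \<Rightarrow> nat \<Rightarrow> int" where
  "crossing_sign D c = (if kind D c = First_Over then rot D c else - rot D c)"

definition crossing_type :: "long_diagram \<Rightarrow> nat \<Rightarrow> nat" where
  "crossing_type D c = (if kind D c = First_Over then 0 else 1)"


section \<open>Long virtual knots\<close>

definition same_crossings :: "nat set \<Rightarrow> long_diagram \<Rightarrow> long_diagram \<Rightarrow> bool" where
  "same_crossings S D D' \<longleftrightarrow> (\<forall>c\<in>S. rot D' c = rot D c \<and> kind D' c = kind D c)"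

text \<open>
  Third moves, for strands numbered in the order of passage, with \<open>k12\<close> the kind of the crossing of
  strands 1 and 2, etc.: all crossings virtual; exactly two of them virtual (mixed move: the strand
  through both virtual crossings passes a real crossing); or all of them real, with a top, a middle
  and a bottom strand.
\<close>

fun third_move_kinds :: "crossing_kind \<Rightarrow> crossing_kind \<Rightarrow> crossing_kind \<Rightarrow> bool" where
  "third_move_kinds k12 k13 k23 \<longleftrightarrow>
     (let v = length (filter (\<lambda>k. k = Virtual) [k12, k13, k23]) in
      v = 3 \<or> v = 2 \<or>
      v = 0 \<and> (k12, k23, k13) \<noteq> (First_Over, First_Over, First_Under)
            \<and> (k12, k23, k13) \<noteq> (First_Under, First_Under, First_Over))"

text \<open>The edges \<open>k1\<close>, \<open>k2\<close>, \<open>k3\<close> bound a triangular region.\<close>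

definition triangle :: "nat list \<Rightarrow> (nat \<Rightarrow> int) \<Rightarrow> nat \<Rightarrow> nat \<Rightarrow> nat \<Rightarrow> bool" where
  "triangle w r k1 k2 k3 \<longleftrightarrow>
     (\<exists>f\<in>faces w r. card f = 3 \<and> fst ` f = {k1, k2, k3})"

text \<open>
  Each rule comprises the real and the virtual version of a move. Since both sides are diagrams,
  the crossings created by a move are automatically new and distinct, and the curve stays planar.
  A pair of crossings as in the second move automatically bounds a bigon.
\<close>

inductive reidemeister :: "long_diagram \<Rightarrow> long_diagram \<Rightarrow> bool" where
  relabel:
    "\<lbrakk>inj_on f (set (word D)); word D' = map f (word D);
      \<forall>c\<in>set (word D). rot D' (f c) = rot D c \<and> kind D' (f c) = kind D c\<rbrakk>
     \<Longrightarrow> reidemeister D D'"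
| first:
    "\<lbrakk>word D = A @ B; word D' = A @ [c, c] @ B; same_crossings (set (word D)) D D'\<rbrakk>
     \<Longrightarrow> reidemeister D D'"
| second:
    "\<lbrakk>word D = A @ B @ C;
      word D' = A @ [c, d] @ B @ [c, d] @ C \<or> word D' = A @ [c, d] @ B @ [d, c] @ C;
      same_crossings (set (word D)) D D'; kind D' c = kind D' d; rot D' c = - rot D' d\<rbrakk>
     \<Longrightarrow> reidemeister D D'"
| third:
    "\<lbrakk>word D = A @ [x1, x2] @ B @ [y1, y2] @ C @ [z1, z2] @ E;
      word D' = A @ [x2, x1] @ B @ [y2, y1] @ C @ [z2, z1] @ E;
      {x1, x2} = {c12, c13}; {y1, y2} = {c12, c23}; {z1, z2} = {c13, c23};
      triangle (word D) (rot D) (length A + 1) (length A + length B + 3)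
        (length A + length B + length C + 5);
      same_crossings (set (word D)) D D';
      third_move_kinds (kind D c12) (kind D c13) (kind D c23)\<rbrakk>
     \<Longrightarrow> reidemeister D D'"

quotient_type long_virtual_knot = long_diagram / "equivclp reidemeister"
  by simp

definition knot_of :: "long_diagram \<Rightarrow> long_virtual_knot" where
  "knot_of D = abs_long_virtual_knot D"


section \<open>Intersection polynomials\<close>

text \<open>
  Surface realization of \<open>D\<close>: the curve with code \<open>(real_word D, rot D)\<close>, on the closed oriented
  surface of genus \<open>g\<close> with \<open>euler_char (real_word D) (rot D) = 2 - 2 * g\<close>.
\<close>

definition real_word :: "long_diagram \<Rightarrow> nat list" where
  "real_word D = filter (\<lambda>c. kind D c \<noteq> Virtual) (word D)"

definition alpha :: "long_diagram \<Rightarrow> nat \<Rightarrow> nat \<Rightarrow> int" where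
  "alpha D c k =
     (if first_pos (real_word D) c < k \<and> k \<le> second_pos (real_word D) c then 1 else 0)"

definition beta :: "long_diagram \<Rightarrow> nat \<Rightarrow> nat \<Rightarrow> int" where
  "beta D c k =
     (if k \<le> first_pos (real_word D) c
         \<or> second_pos (real_word D) c < k \<and> k \<le> length (real_word D) then 1 else 0)"

definition isect :: "long_diagram \<Rightarrow> (nat \<Rightarrow> int) \<Rightarrow> (nat \<Rightarrow> int) \<Rightarrow> int" where
  "isect D x y = intersection_number (real_word D) (rot D) x y"

text \<open>Laurent polynomials over the integers are the group ring of the integers.\<close>

type_synonym laurent = "int \<Rightarrow>\<^sub>0 int"

definition tpow :: "int \<Rightarrow> laurent" where
  "tpow k = Poly_Mapping.single k 1"

definition invert_t :: "laurent \<Rightarrow> laurent" where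
  "invert_t p = Poly_Mapping.map_key uminus p"

definition crossings_of_type :: "long_diagram \<Rightarrow> nat \<Rightarrow> nat set" where
  "crossings_of_type D a = {c \<in> real_crossings D. crossing_type D c = a}"

definition omega :: "long_diagram \<Rightarrow> nat \<Rightarrow> laurent" where
  "omega D a = of_int (\<Sum>i\<in>crossings_of_type D a. crossing_sign D i)"

definition W_diagram :: "nat \<Rightarrow> long_diagram \<Rightarrow> laurent" where
  "W_diagram a D =
     (\<Sum>i\<in>crossings_of_type D a.
        of_int (crossing_sign D i) * (tpow (isect D (alpha D i) (beta D i)) - 1))"

definition F_diagram :: "nat \<Rightarrow> nat \<Rightarrow> long_diagram \<Rightarrow> laurent" where
  "F_diagram a b D =
     (\<Sum>i\<in>crossings_of_type D a. \<Sum>j\<in>crossings_of_type D b.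
        of_int (crossing_sign D i * crossing_sign D j) *
        (tpow (isect D (alpha D i) (alpha D j)) - 1))"

definition G_diagram :: "nat \<Rightarrow> nat \<Rightarrow> long_diagram \<Rightarrow> laurent" where
  "G_diagram a b D =
     (\<Sum>i\<in>crossings_of_type D a. \<Sum>j\<in>crossings_of_type D b.
        of_int (crossing_sign D i * crossing_sign D j) *
        (tpow (isect D (alpha D i) (beta D j)) - 1))
     - omega D b * W_diagram a D"

definition H_diagram :: "nat \<Rightarrow> nat \<Rightarrow> long_diagram \<Rightarrow> laurent" where
  "H_diagram a b D =
     (\<Sum>i\<in>crossings_of_type D a. \<Sum>j\<in>crossings_of_type D b.
        of_int (crossing_sign D i * crossing_sign D j) *
        (tpow (isect D (beta D i) (beta D j)) - 1))
     - omega D a * W_diagram b D - omega D b * invert_t (W_diagram a D)"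

text \<open>
  The polynomials of a knot are computed from a diagram representing it; they do not depend on
  the choice.
\<close>

definition F_poly :: "nat \<Rightarrow> nat \<Rightarrow> long_virtual_knot \<Rightarrow> laurent" where
  "F_poly a b K = F_diagram a b (rep_long_virtual_knot K)"

definition G_poly :: "nat \<Rightarrow> nat \<Rightarrow> long_virtual_knot \<Rightarrow> laurent" where
  "G_poly a b K = G_diagram a b (rep_long_virtual_knot K)"

definition H_poly :: "nat \<Rightarrow> nat \<Rightarrow> long_virtual_knot \<Rightarrow> laurent" where
  "H_poly a b K = H_diagram a b (rep_long_virtual_knot K)"


section \<open>Finite-type invariants under virtualizations\<close>

definition marked_diagram :: "nat \<Rightarrow> long_diagram \<Rightarrow> nat set \<Rightarrow> bool" where
  "marked_diagram n D C \<longleftrightarrow> C \<subseteq> real_crossings D \<and> card C = n"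

text \<open>A choice of \<open>\<delta>\<close> is the set \<open>S\<close> of the marked crossings \<open>c\<^sub>i\<close> with \<open>\<delta>\<^sub>i = 1\<close>.\<close>

definition alternating_sum ::
  "(long_virtual_knot \<Rightarrow> 'v::ab_group_add) \<Rightarrow> long_diagram \<Rightarrow> nat set \<Rightarrow> 'v" where
  "alternating_sum v D C =
     (\<Sum>S\<in>Pow C. if even (card S) then v (knot_of (virtualize S D))
                 else - v (knot_of (virtualize S D)))"

definition finite_type :: "(long_virtual_knot \<Rightarrow> 'v::ab_group_add) \<Rightarrow> bool" where
  "finite_type v \<longleftrightarrow> finite {n. \<exists>D C. marked_diagram n D C \<and> alternating_sum v D C \<noteq> 0}"

end

theory Submission
  imports Defs
begin

text \<open>
  The proof computes the alternating sums for one planar family of diagrams and looks at a single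
  coefficient.

  Let \<open>\<gamma>\<close> be the whole curve, so that \<open>\<beta>\<^sub>i = \<gamma> - \<alpha>\<^sub>i\<close>. Expanding the products of \<open>\<omega>\<close> and \<open>W\<close> shows
  that each of the three polynomials is a double sum of terms
  \<open>\<epsilon>\<^sub>i \<epsilon>\<^sub>j \<Phi>(\<alpha>\<^sub>i \<cdot> \<alpha>\<^sub>j, \<alpha>\<^sub>i \<cdot> \<gamma>, \<alpha>\<^sub>j \<cdot> \<gamma>)\<close> (\<open>double_sum\<close>), where \<open>\<Phi>\<close> vanishes as soon as one of the
  two arcs is null-homologous. The intersection numbers are sums of local contributions of the real
  crossings that depend on the order of passages only (\<open>isect_eq_pairing\<close>).

  The value of a polynomial on a knot refers to an unspecified diagram of the knot, so invariance under
  the generalized Reidemeister moves is needed (\<open>double_sum_reidemeister\<close>). A first move adds a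
  null-homologous arc. A second move adds two homologous arcs with opposite signs. A third move
  keeps all intersection numbers; this rests on the relation between orders and
  orientations at the corners of a triangular face (\<open>triangle_signs\<close>). Virtual and mixed moves
  do not affect the order of the passages of real crossings.

  The diagrams are rows of \<open>2n + 1\<close> crossings between two strands, closed like the torus knot
  \<open>T(2, 2n + 1)\<close>, with every second crossing virtual. They are planar (\<open>euler_char_twist\<close>). All
  chords of the \<open>n + 1\<close> real crossings are interlaced in the same way. If \<open>R\<close> is the set of those that
  remain after some virtualizations and \<open>h\<^sub>i\<close> is the number of elements of \<open>R\<close> after \<open>i\<close> minus the
  number of those before \<open>i\<close>, then \<open>\<alpha>\<^sub>i \<cdot> \<gamma> = h\<^sub>i\<close> and \<open>\<alpha>\<^sub>i \<cdot> \<alpha>\<^sub>j = (h\<^sub>i - h\<^sub>j) / 2\<close> (\<open>twist_pairing\<close>). All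
  exponents are bounded by the maximal \<open>\<bar>h\<^sub>i\<bar>\<close>, which is at most \<open>card R - 1\<close>. Hence, if all real crossings
  are marked, only the diagram without virtualizations contributes to the coefficient of \<open>t\<^sup>n\<close> in the
  alternating sum. In that diagram the contributions to \<open>t\<^sup>n\<close> all have the same sign, and with a
  suitable choice of types one of them is not zero. So the alternating sum is not zero for any
  number \<open>n + 1 \<ge> 2\<close> of marked crossings.
\<close>

section \<open>Order of passages\<close>

text \<open>
  Only the order in which the passages are met matters for intersection numbers. To compare this order
  in two words it suffices to know how the sets of occurrences correspond under a map of positions.
\<close>

definition occurrences :: "nat list \<Rightarrow> nat \<Rightarrow> nat set" where
  "occurrences w c = {i. i < length w \<and> w ! i = c}"

definition passage :: "nat list \<Rightarrow> nat \<Rightarrow> bool \<Rightarrow> nat" where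
  "passage w c u = (if u then second_pos w c else first_pos w c)"

lemma card_occurrences: "card (occurrences w c) = count_list w c"
  by (simp add: occurrences_def count_list_eq_length_filter length_filter_conv_card eq_commute[of c])

lemma first_pos_eq:
  assumes "occurrences w c = {p, q}" "p < q"
  shows "first_pos w c = p"
proof -
  have "first_pos w c = (LEAST i. i \<in> occurrences w c)"
    by (simp add: first_pos_def occurrences_def)
  also have "\<dots> = p"
    unfolding assms(1) using assms(2) by (intro Least_equality) auto
  finally show ?thesis .
qed

lemma second_pos_eq:
  assumes "occurrences w c = {p, q}" "p < q"
  shows "second_pos w c = q"
proof -
  have "second_pos w c = (GREATEST i. i \<in> occurrences w c)"
    by (simp add: second_pos_def occurrences_def)
  also have "\<dots> = q"
    unfolding assms(1) using assms(2) by (intro Greatest_equality) auto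
  finally show ?thesis .
qed

lemma occurrences_twice:
  assumes "count_list w c = 2"
  shows "occurrences w c = {passage w c False, passage w c True}"
    and "passage w c False < passage w c True"
proof -
  obtain x y where xy: "occurrences w c = {x, y}" "x \<noteq> y"
    using assms card_occurrences[of w c] by (metis card_2_iff)
  obtain p q where pq: "occurrences w c = {p, q}" "p < q"
  proof (cases "x < y")
    case True
    then show ?thesis using that[OF xy(1)] by simp
  next
    case False
    then show ?thesis using that[of y x] xy by (simp add: insert_commute)
  qed
  have "passage w c False = p" "passage w c True = q"
    using first_pos_eq[OF pq] second_pos_eq[OF pq] by (simp_all add: passage_def)
  then show "occurrences w c = {passage w c False, passage w c True}"
    and "passage w c False < passage w c True"
    using pq by simp_all
qed

lemma passage_eqI:
  assumes "occurrences w c = {p, q}" "p < q"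
  shows "passage w c u = (if u then q else p)"
  using first_pos_eq[OF assms] second_pos_eq[OF assms] by (simp add: passage_def)

lemma passage_nth:
  assumes "count_list w c = 2"
  shows "passage w c u < length w" "w ! passage w c u = c"
proof -
  have "passage w c u \<in> occurrences w c"
    using occurrences_twice(1)[OF assms] by (cases u) auto
  then show "passage w c u < length w" "w ! passage w c u = c"
    by (auto simp: occurrences_def)
qed

lemma passage_inj:
  assumes "count_list w c = 2" "count_list w e = 2"
  shows "passage w c u = passage w e v \<longleftrightarrow> c = e \<and> u = v"
proof
  assume eq: "passage w c u = passage w e v"
  then have "c = e" using passage_nth(2)[OF assms(1), of u] passage_nth(2)[OF assms(2), of v] by simp
  with eq show "c = e \<and> u = v"
    using occurrences_twice(2)[OF assms(1)] by (cases u; cases v) auto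
qed auto

lemma passage_transport:
  assumes "count_list v c = 2" and occ: "occurrences w d = g ` occurrences v c"
    and mono: "g (passage v c False) < g (passage v c True)"
  shows "passage w d u = g (passage v c u)"
proof -
  have "occurrences w d = {g (passage v c False), g (passage v c True)}"
    using occ occurrences_twice(1)[OF assms(1)] by simp
  from passage_eqI[OF this mono] show ?thesis by (cases u) auto
qed

text \<open>
  Deleting letters does not change the order of the others: the positions of the surviving letters
  are mapped into the original word by an increasing function.
\<close>

lemma filter_index_embedding:
  obtains g where "strict_mono_on {..<length (filter P w)} g"
    and "\<And>c. P c \<Longrightarrow> occurrences w c = g ` occurrences (filter P w) c"
proof -
  define idx where "idx = filter (\<lambda>i. P (w ! i)) [0..<length w]"
  have w: "filter P w = map ((!) w) idx"
    unfolding idx_def using filter_map[of P "(!) w" "[0..<length w]"] by (simp add: map_nth comp_def)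
  have "sorted_wrt (<) idx" unfolding idx_def by (intro sorted_wrt_filter) simp
  then have mono: "strict_mono_on {..<length (filter P w)} ((!) idx)"
    by (auto simp: w strict_mono_on_def intro: sorted_wrt_nth_less)
  have "occurrences w c = (!) idx ` occurrences (filter P w) c" if "P c" for c
  proof -
    have "i \<in> set idx" if "i < length w" "w ! i = c" for i
      using that \<open>P c\<close> by (auto simp: idx_def)
    moreover have "i < length w" if "i \<in> set idx" for i
      using that by (auto simp: idx_def)
    ultimately show ?thesis
      by (fastforce simp: occurrences_def w in_set_conv_nth image_iff)
  qed
  with mono show thesis by (rule that)
qed

text \<open>
  The cycle \<open>\<alpha>\<^sub>c\<close> near a passage: the sum of its coefficients on the edge that ends there and on the
  edge that starts there. So the value is \<open>2\<close> between the two passages of \<open>c\<close>, \<open>1\<close> at these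
  passages, and \<open>0\<close> elsewhere. Written with signs, it visibly depends on the order of passages only.
\<close>

definition arc_side :: "nat list \<Rightarrow> nat \<Rightarrow> nat \<Rightarrow> bool \<Rightarrow> int" where
  "arc_side w c e u = sgn (int (passage w e u) - int (passage w c False))
                    + sgn (int (passage w c True) - int (passage w e u))"

lemma count_list_filter: "P c \<Longrightarrow> count_list (filter P w) c = count_list w c"
  by (induction w) auto

text \<open>
  This allows all positions to be read off from the word of the whole plane curve, although
  surface realizations are built from the real crossings alone. It also compares the two sides of a
  first or second move.
\<close>

lemma arc_side_filter:
  assumes "count_list w c = 2" "count_list w e = 2" "P c" "P e"
  shows "arc_side (filter P w) c e u = arc_side w c e u"
proof -
  let ?v = "filter P w"
  obtain g where g: "strict_mono_on {..<length ?v} g"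
    and occ: "\<And>c. P c \<Longrightarrow> occurrences w c = g ` occurrences ?v c"
    by (rule filter_index_embedding[of P w]) auto
  have less: "g i < g j \<longleftrightarrow> i < j" if "i < length ?v" "j < length ?v" for i j
    using g that by (simp add: strict_mono_on_less)
  have pos: "passage w d u = g (passage ?v d u)" if "count_list w d = 2" "P d" for d u
  proof (rule passage_transport)
    show d: "count_list ?v d = 2" using that by (simp add: count_list_filter)
    show "occurrences w d = g ` occurrences ?v d" using occ that by blast
    show "g (passage ?v d False) < g (passage ?v d True)"
      using occurrences_twice(2)[OF d] by (simp add: less passage_nth(1)[OF d])
  qed
  have sgn_g: "sgn (int (g i) - int (g j)) = sgn (int i - int j)"
    if "i < length ?v" "j < length ?v" for i j
    using less[OF that] less[OF that(2,1)] by (auto simp: sgn_if)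
  have len: "passage ?v d u < length ?v" if "count_list w d = 2" "P d" for d u
    using that by (intro passage_nth(1)) (simp add: count_list_filter)
  show ?thesis
    using assms by (simp add: arc_side_def pos sgn_g len)
qed

lemma arc_side_self:
  assumes "count_list w c = 2"
  shows "arc_side w c c u = 1"
  using occurrences_twice(2)[OF assms] by (cases u) (auto simp: arc_side_def)

lemma arc_side_other:
  assumes "count_list w c = 2" "count_list w e = 2" "c \<noteq> e"
  shows "arc_side w c e u \<in> {0, 2}"
proof -
  have "passage w e u \<noteq> passage w c v" for v
    using assms by (simp add: passage_inj)
  from this[of True] this[of False] show ?thesis
    using occurrences_twice(2)[OF assms(1)] by (auto simp: arc_side_def sgn_if)
qed

section \<open>Intersection numbers as a sum over crossings\<close>

text \<open>
  Four times the intersection number, for cycles given by their sums over the two edges at each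
  passage. The set of crossings is a parameter, so that virtualizing a crossing just omits a summand.
\<close>

definition pairing ::
  "(nat \<Rightarrow> int) \<Rightarrow> nat set \<Rightarrow> (nat \<Rightarrow> bool \<Rightarrow> int) \<Rightarrow> (nat \<Rightarrow> bool \<Rightarrow> int) \<Rightarrow> int" where
  "pairing r S x y = (\<Sum>e\<in>S. r e * (x e False * y e True - x e True * y e False))"

lemma pairing_flip: "pairing r S y x = - pairing r S x y"
  by (simp add: pairing_def sum_negf[symmetric] algebra_simps)

lemma pairing_cong:
  assumes "\<And>e. e \<in> S \<Longrightarrow> r e = r' e" "\<And>e u. e \<in> S \<Longrightarrow> x e u = x' e u"
    "\<And>e u. e \<in> S \<Longrightarrow> y e u = y' e u"
  shows "pairing r S x y = pairing r' S x' y'"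
  using assms by (simp add: pairing_def)



lemma vertex_sum:
  shows "(\<Sum>j<4. \<Sum>i<j. [a0, a1, a2, a3] ! i * [b0, b1, b2, b3] ! j - [a0, a1, a2, a3] ! j * [b0, b1, b2, b3] ! i)
     = (a0 * b1 - a1 * b0) + (a0 * b2 - a2 * b0) + (a0 * b3 - a3 * b0)
     + (a1 * b2 - a2 * b1) + (a1 * b3 - a3 * b1) + (a2 * b3 - a3 * (b2 :: int))"
  by (simp add: eval_nat_numeral lessThan_Suc)

text \<open>
  At a double point a cycle is determined by three of its four coefficients. The form has rank two
  there: it depends only on the sums of the coefficients along each of the two strands, and is
  the determinant of these sums up to a factor.
\<close>

lemma vertex_contribution:
  assumes r: "r c \<in> {1, - 1}" and pq: "p = first_pos w c" "q = second_pos w c"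
    and x: "x (p + 1) + x (q + 1) = x p + x q" and y: "y (p + 1) + y (q + 1) = y p + y q"
  shows "2 * (\<Sum>j<4. \<Sum>i<j. outflow w r c x ! i * outflow w r c y ! j
                        - outflow w r c x ! j * outflow w r c y ! i)
       = r c * ((x p + x (p + 1)) * (y q + y (q + 1)) - (x q + x (q + 1)) * (y p + y (p + 1)))"
proof -
  have eqs: "x (q + 1) = x p + x q - x (p + 1)" "y (q + 1) = y p + y q - y (p + 1)"
    using x y by linarith+
  consider "r c = 1" | "r c = - 1" using r by blast
  then show ?thesis
  proof cases
    case 1
    then have "outflow w r c z = [z (p + 1), z (q + 1), - z p, - z q]" for z
      by (simp add: outflow_def Let_def pq)
    then show ?thesis using 1 by (simp only: vertex_sum eqs) (simp add: algebra_simps)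
  next
    case 2
    then have "outflow w r c z = [z (p + 1), - z q, - z p, z (q + 1)]" for z
      by (simp add: outflow_def Let_def pq)
    then show ?thesis using 2 by (simp only: vertex_sum eqs) (simp add: algebra_simps)
  qed
qed

lemma count_word: "c \<in> set (word D) \<Longrightarrow> count_list (word D) c = 2"
  by transfer auto

lemma rot_sign: "c \<in> set (word D) \<Longrightarrow> rot D c \<in> {1, - 1}"
  by transfer auto

lemma real_crossings_subset: "real_crossings D \<subseteq> set (word D)"
  by (auto simp: real_crossings_def)

lemma finite_real_crossings [simp]: "finite (real_crossings D)"
  by (rule finite_subset[OF real_crossings_subset]) simp

lemma finite_crossings_of_type [simp]: "finite (crossings_of_type D a)"
  by (simp add: crossings_of_type_def)

lemma set_real_word: "set (real_word D) = real_crossings D"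
  by (auto simp: real_word_def real_crossings_def)

lemma count_real_word: "c \<in> real_crossings D \<Longrightarrow> count_list (real_word D) c = 2"
  by (simp add: real_word_def real_crossings_def count_list_filter count_word)

lemma pairing_complement_right:
  "pairing r S x (\<lambda>e u. 2 - y e u) = pairing r S x (\<lambda>_ _. 2) - pairing r S x y"
  by (simp add: pairing_def sum_subtractf[symmetric] algebra_simps)

lemma pairing_complement_left:
  "pairing r S (\<lambda>e u. 2 - x e u) y = - pairing r S y (\<lambda>_ _. 2) - pairing r S x y"
  by (simp add: pairing_def sum_subtractf[symmetric] sum_negf[symmetric] algebra_simps)

lemma pairing_self [simp]: "pairing r S x x = 0"
  by (simp add: pairing_def algebra_simps)

lemma pairing_const [simp]: "pairing r S (\<lambda>_ _. k) (\<lambda>_ _. l) = 0"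
  by (simp add: pairing_def algebra_simps)

lemma isect_eq_pairing:
  assumes x: "\<And>e. e \<in> real_crossings D \<Longrightarrow>
      (\<Sum>u\<in>UNIV. x (passage (real_word D) e u + 1)) = (\<Sum>u\<in>UNIV. x (passage (real_word D) e u))"
    and y: "\<And>e. e \<in> real_crossings D \<Longrightarrow>
      (\<Sum>u\<in>UNIV. y (passage (real_word D) e u + 1)) = (\<Sum>u\<in>UNIV. y (passage (real_word D) e u))"
    and X: "\<And>e u. e \<in> real_crossings D \<Longrightarrow>
      X e u = x (passage (real_word D) e u) + x (passage (real_word D) e u + 1)"
    and Y: "\<And>e u. e \<in> real_crossings D \<Longrightarrow>
      Y e u = y (passage (real_word D) e u) + y (passage (real_word D) e u + 1)"
  shows "isect D x y = pairing (rot D) (real_crossings D) X Y div 4"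
proof -
  let ?w = "real_word D"
  let ?s = "\<lambda>c. \<Sum>j<4. \<Sum>i<j. outflow ?w (rot D) c x ! i * outflow ?w (rot D) c y ! j
                        - outflow ?w (rot D) c x ! j * outflow ?w (rot D) c y ! i"
  have s: "2 * ?s c = rot D c * (X c False * Y c True - X c True * Y c False)"
    if c: "c \<in> real_crossings D" for c
  proof -
    have r: "rot D c \<in> {1, - 1}" by (rule rot_sign[OF subsetD[OF real_crossings_subset c]])
    have P: "first_pos ?w c = passage ?w c False" "second_pos ?w c = passage ?w c True"
      by (simp_all add: passage_def)
    show ?thesis
      using vertex_contribution[where r = "rot D" and c = c, OF r P[symmetric], of x y] x[OF c] y[OF c]
      by (simp add: X[OF c] Y[OF c] UNIV_bool algebra_simps)
  qed
  have "2 * sum ?s (real_crossings D) = pairing (rot D) (real_crossings D) X Y"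
    unfolding pairing_def sum_distrib_left[where A = "real_crossings D"] by (intro sum.cong refl s)
  moreover have "isect D x y = sum ?s (real_crossings D) div 2"
    by (simp add: isect_def intersection_number_def set_real_word)
  ultimately show ?thesis by linarith
qed

lemma alpha_at_passage:
  assumes c: "c \<in> real_crossings D" and e: "e \<in> real_crossings D"
  shows "alpha D c (passage (real_word D) e u) + alpha D c (passage (real_word D) e u + 1)
          = arc_side (word D) c e u"
    and "(\<Sum>u\<in>UNIV. alpha D c (passage (real_word D) e u + 1))
          = (\<Sum>u\<in>UNIV. alpha D c (passage (real_word D) e u))"
proof -
  let ?P = "passage (real_word D)"
  have a: "alpha D c k = of_bool (?P c False < k \<and> k \<le> ?P c True)" for k
    by (simp add: alpha_def passage_def)
  have lt: "?P c False < ?P c True" "?P e False < ?P e True"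
    using c e by (simp_all add: occurrences_twice(2) count_real_word)
  have "arc_side (word D) c e u = arc_side (real_word D) c e u"
    using c e by (simp add: real_word_def real_crossings_def arc_side_filter count_word)
  also have "\<dots> = alpha D c (?P e u) + alpha D c (?P e u + 1)"
    unfolding arc_side_def a using lt by (auto simp: sgn_if)
  finally show "alpha D c (?P e u) + alpha D c (?P e u + 1) = arc_side (word D) c e u" ..
  show "(\<Sum>u\<in>UNIV. alpha D c (?P e u + 1)) = (\<Sum>u\<in>UNIV. alpha D c (?P e u))"
  proof (cases "c = e")
    case True
    show ?thesis unfolding a using True lt by (auto simp: UNIV_bool)
  next
    case False
    then have "?P c v \<noteq> ?P e u" for u v
      using c e by (simp add: passage_inj count_real_word)
    then have "alpha D c (?P e u + 1) = alpha D c (?P e u)" for u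
      unfolding a by (simp add: less_Suc_eq Suc_le_eq order.strict_iff_order[of _ "?P c True"] eq_commute[of "?P e u"])
    then show ?thesis by simp
  qed
qed

lemma beta_at_passage:
  assumes c: "c \<in> real_crossings D" and e: "e \<in> real_crossings D"
  shows "beta D c (passage (real_word D) e u) = 1 - alpha D c (passage (real_word D) e u)"
    and "beta D c (passage (real_word D) e u + 1) = 1 - alpha D c (passage (real_word D) e u + 1)"
proof -
  have "passage (real_word D) e u < length (real_word D)"
    using e by (simp add: passage_nth(1) count_real_word)
  moreover have "first_pos (real_word D) c < second_pos (real_word D) c"
    using occurrences_twice(2)[OF count_real_word[OF c]] by (simp add: passage_def)
  ultimately show "beta D c (passage (real_word D) e u) = 1 - alpha D c (passage (real_word D) e u)"
    "beta D c (passage (real_word D) e u + 1) = 1 - alpha D c (passage (real_word D) e u + 1)"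
    by (auto simp: alpha_def beta_def)
qed

section \<open>The intersection polynomials as double sums\<close>

text \<open>
  The numbers \<open>4 \<alpha>\<^sub>i \<cdot> \<alpha>\<^sub>j\<close> and \<open>4 \<alpha>\<^sub>i \<cdot> \<gamma>\<close>; the whole curve \<open>\<gamma>\<close> has coefficient \<open>1\<close> on every edge,
  hence the constant \<open>2\<close>.
\<close>

definition arc_pairing :: "long_diagram \<Rightarrow> nat \<Rightarrow> nat \<Rightarrow> int" where
  "arc_pairing D i j = pairing (rot D) (real_crossings D) (arc_side (word D) i) (arc_side (word D) j)"

definition arc_index :: "long_diagram \<Rightarrow> nat \<Rightarrow> int" where
  "arc_index D i = pairing (rot D) (real_crossings D) (arc_side (word D) i) (\<lambda>_ _. 2)"

text \<open>
  From \<open>\<beta>\<^sub>i = \<gamma> - \<alpha>\<^sub>i\<close>, bilinearity and antisymmetry.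
\<close>

lemma isect_alpha_beta:
  assumes i: "i \<in> real_crossings D" and j: "j \<in> real_crossings D"
  shows "isect D (alpha D i) (alpha D j) = arc_pairing D i j div 4"
    and "isect D (alpha D i) (beta D j) = (arc_index D i - arc_pairing D i j) div 4"
    and "isect D (beta D i) (beta D j) = (arc_index D j - arc_index D i + arc_pairing D i j) div 4"
proof -
  note a = alpha_at_passage and b = beta_at_passage
  let ?S = "real_crossings D" and ?x = "arc_side (word D)"
  show "isect D (alpha D i) (alpha D j) = arc_pairing D i j div 4"
    unfolding arc_pairing_def using i j by (intro isect_eq_pairing) (simp_all add: a del: One_nat_def)
  have "isect D (alpha D i) (beta D j)
      = pairing (rot D) ?S (?x i) (\<lambda>e u. 2 - ?x j e u) div 4"
    using i j by (intro isect_eq_pairing) (simp_all add: a(2) b sum_subtractf a(1)[symmetric] del: One_nat_def)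
  then show "isect D (alpha D i) (beta D j) = (arc_index D i - arc_pairing D i j) div 4"
    by (simp add: pairing_complement_right arc_pairing_def arc_index_def)
  have "isect D (beta D i) (beta D j)
      = pairing (rot D) ?S (\<lambda>e u. 2 - ?x i e u) (\<lambda>e u. 2 - ?x j e u) div 4"
    using i j by (intro isect_eq_pairing) (simp_all add: a(2) b sum_subtractf a(1)[symmetric] del: One_nat_def)
  also have "pairing (rot D) ?S (\<lambda>e u. 2 - ?x i e u) (\<lambda>e u. 2 - ?x j e u)
      = arc_index D j - arc_index D i + arc_pairing D i j"
    by (simp add: pairing_complement_right pairing_complement_left arc_pairing_def arc_index_def
        pairing_flip[of _ _ "\<lambda>_ _. 2"])
  finally show "isect D (beta D i) (beta D j)
      = (arc_index D j - arc_index D i + arc_pairing D i j) div 4" .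
qed

text \<open>
  All three polynomials have this form. Since \<open>\<beta>\<^sub>i = \<gamma> - \<alpha>\<^sub>i\<close> for the whole curve \<open>\<gamma>\<close>, the exponents
  are determined by \<open>\<alpha>\<^sub>i \<cdot> \<alpha>\<^sub>j\<close>, \<open>\<alpha>\<^sub>i \<cdot> \<gamma>\<close> and \<open>\<alpha>\<^sub>j \<cdot> \<gamma>\<close>; the products of \<open>\<omega>\<close> and \<open>W\<close> that
  are subtracted are double sums over the same index set.
\<close>

definition double_sum ::
  "(int \<Rightarrow> int \<Rightarrow> int \<Rightarrow> laurent) \<Rightarrow> nat \<Rightarrow> nat \<Rightarrow> long_diagram \<Rightarrow> laurent" where
  "double_sum \<Phi> a b D =
     (\<Sum>i\<in>crossings_of_type D a. \<Sum>j\<in>crossings_of_type D b.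
        of_int (crossing_sign D i * crossing_sign D j)
          * \<Phi> (arc_pairing D i j) (arc_index D i) (arc_index D j))"

text \<open>
  The arguments are \<open>4 \<alpha>\<^sub>i \<cdot> \<alpha>\<^sub>j\<close>, \<open>4 \<alpha>\<^sub>i \<cdot> \<gamma>\<close> and \<open>4 \<alpha>\<^sub>j \<cdot> \<gamma>\<close>. For \<open>H\<close> note that
  \<open>\<beta>\<^sub>i \<cdot> \<beta>\<^sub>j = \<alpha>\<^sub>j \<cdot> \<gamma> - \<alpha>\<^sub>i \<cdot> \<gamma> + \<alpha>\<^sub>i \<cdot> \<alpha>\<^sub>j\<close>.
\<close>

definition F_term :: "int \<Rightarrow> int \<Rightarrow> int \<Rightarrow> laurent" where
  "F_term x u v = tpow (x div 4) - 1"

definition G_term :: "int \<Rightarrow> int \<Rightarrow> int \<Rightarrow> laurent" where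
  "G_term x u v = tpow ((u - x) div 4) - tpow (u div 4)"

definition H_term :: "int \<Rightarrow> int \<Rightarrow> int \<Rightarrow> laurent" where
  "H_term x u v = tpow ((v - u + x) div 4) - tpow (v div 4) - tpow (- (u div 4)) + 1"

lemma lookup_of_int_times:
  "Poly_Mapping.lookup (of_int z * p :: laurent) k = z * Poly_Mapping.lookup p k"
proof (induction z rule: int_induct[of _ 0])
  case (step1 i)
  then show ?case by (simp add: distrib_right lookup_add)
next
  case (step2 i)
  then show ?case by (simp add: left_diff_distrib lookup_minus)
qed simp

lemma lookup_tpow: "Poly_Mapping.lookup (tpow k) m = of_bool (k = m)"
  by (simp add: tpow_def lookup_single when_def)

lemma tpow_0: "tpow 0 = 1"
  by (simp add: tpow_def)

lemma lookup_invert_t: "Poly_Mapping.lookup (invert_t p) k = Poly_Mapping.lookup p (- k)"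
  by (simp add: invert_t_def map_key.rep_eq)

lemma invert_t_sum:
  "invert_t (\<Sum>i\<in>S. of_int (z i) * (tpow (k i) - 1)) = (\<Sum>i\<in>S. of_int (z i) * (tpow (- k i) - 1))"
proof (rule poly_mapping_eqI)
  fix m
  have [simp]: "k i = - m \<longleftrightarrow> - k i = m" for i by auto
  show "Poly_Mapping.lookup (invert_t (\<Sum>i\<in>S. of_int (z i) * (tpow (k i) - 1))) m
      = Poly_Mapping.lookup (\<Sum>i\<in>S. of_int (z i) * (tpow (- k i) - 1)) m"
    by (simp add: lookup_invert_t lookup_sum lookup_of_int_times lookup_minus lookup_tpow
        tpow_0[symmetric] minus_equation_iff)
qed

lemma crossings_of_type_real: "i \<in> crossings_of_type D a \<Longrightarrow> i \<in> real_crossings D"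
  by (simp add: crossings_of_type_def)

lemma W_diagram_eq:
  "W_diagram a D = (\<Sum>i\<in>crossings_of_type D a.
     of_int (crossing_sign D i) * (tpow (arc_index D i div 4) - 1))"
  unfolding W_diagram_def
  by (intro sum.cong refl) (simp add: isect_alpha_beta crossings_of_type_real arc_pairing_def)

lemma F_diagram_eq: "F_diagram a b D = double_sum F_term a b D"
  unfolding F_diagram_def double_sum_def F_term_def
  by (intro sum.cong refl) (simp add: isect_alpha_beta crossings_of_type_real)

lemma omega_times_right:
  "omega D b * (\<Sum>i\<in>S. of_int (f i) * g i)
     = (\<Sum>i\<in>S. \<Sum>j\<in>crossings_of_type D b. of_int (f i * crossing_sign D j) * g i)"
  unfolding omega_def of_int_sum sum_product
  by (subst sum.swap) (simp add: mult_ac)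

lemma omega_times_left:
  "omega D a * (\<Sum>j\<in>S. of_int (f j) * g j)
     = (\<Sum>i\<in>crossings_of_type D a. \<Sum>j\<in>S. of_int (crossing_sign D i * f j) * g j)"
  unfolding omega_def of_int_sum sum_product
  by (simp add: mult_ac)

lemma G_diagram_eq: "G_diagram a b D = double_sum G_term a b D"
  unfolding G_diagram_def double_sum_def G_term_def W_diagram_eq omega_times_right
    sum_subtractf[symmetric]
  by (intro sum.cong refl) (simp add: isect_alpha_beta crossings_of_type_real algebra_simps)

lemma H_diagram_eq: "H_diagram a b D = double_sum H_term a b D"
  unfolding H_diagram_def double_sum_def H_term_def W_diagram_eq invert_t_sum
    omega_times_left[of D a] omega_times_right[of D b] sum_subtractf[symmetric]
  by (intro sum.cong refl) (simp add: isect_alpha_beta crossings_of_type_real algebra_simps)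

section \<open>Relabelling, first and second moves\<close>

text \<open>
  A double sum depends only on the real crossings with their signs, types and relative positions.
\<close>

lemma double_sum_reindex:
  assumes inj: "inj_on f (real_crossings D)" and real: "real_crossings D' = f ` real_crossings D"
    and data: "\<And>c. c \<in> real_crossings D \<Longrightarrow> rot D' (f c) = rot D c \<and> kind D' (f c) = kind D c"
    and side: "\<And>c e u. \<lbrakk>c \<in> real_crossings D; e \<in> real_crossings D\<rbrakk>
      \<Longrightarrow> arc_side (word D') (f c) (f e) u = arc_side (word D) c e u"
  shows "double_sum \<Phi> a b D' = double_sum \<Phi> a b D"
proof -
  have type: "crossings_of_type D' a = f ` crossings_of_type D a" for a
    unfolding crossings_of_type_def real using data by (auto simp: crossing_type_def)
  have inj': "inj_on f (crossings_of_type D a)" for a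
    using inj by (rule inj_on_subset) (auto simp: crossings_of_type_def)
  have "arc_pairing D' (f i) (f j) = arc_pairing D i j"
    if "i \<in> real_crossings D" "j \<in> real_crossings D" for i j
    unfolding arc_pairing_def pairing_def real sum.reindex[OF inj]
    using that by (simp add: data side)
  moreover have "arc_index D' (f i) = arc_index D i" if "i \<in> real_crossings D" for i
    unfolding arc_index_def pairing_def real sum.reindex[OF inj]
    using that by (simp add: data side)
  moreover have "crossing_sign D' (f i) = crossing_sign D i" if "i \<in> real_crossings D" for i
    using data[OF that] by (simp add: crossing_sign_def)
  ultimately show ?thesis
    unfolding double_sum_def type sum.reindex[OF inj']
    by (simp add: crossings_of_type_real)
qed

lemma double_sum_same_crossings:
  assumes "real_crossings D' = real_crossings D"
    and "\<And>c. c \<in> real_crossings D \<Longrightarrow> rot D' c = rot D c \<and> kind D' c = kind D c"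
    and "\<And>c e u. \<lbrakk>c \<in> real_crossings D; e \<in> real_crossings D\<rbrakk>
      \<Longrightarrow> arc_side (word D') c e u = arc_side (word D) c e u"
  shows "double_sum \<Phi> a b D' = double_sum \<Phi> a b D"
  by (rule double_sum_reindex[of "\<lambda>c. c"]) (use assms in auto)

lemma passage_eqI':
  assumes "count_list w c = 2" "w ! p = c" "w ! q = c" "p < q" "q < length w"
  shows "passage w c u = (if u then q else p)"
proof -
  have "{p, q} \<subseteq> occurrences w c" using assms by (auto simp: occurrences_def)
  moreover have "finite (occurrences w c)" by (simp add: occurrences_def)
  moreover have "card (occurrences w c) = card {p, q}" using assms by (simp add: card_occurrences)
  ultimately have "occurrences w c = {p, q}" by (metis card_subset_eq)
  then show ?thesis using assms by (simp add: passage_eqI)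
qed

lemma double_sum_relabel:
  assumes inj: "inj_on f (set (word D))" and w: "word D' = map f (word D)"
    and data: "\<forall>c\<in>set (word D). rot D' (f c) = rot D c \<and> kind D' (f c) = kind D c"
  shows "double_sum \<Phi> a b D' = double_sum \<Phi> a b D"
proof (rule double_sum_reindex)
  show "inj_on f (real_crossings D)"
    using inj real_crossings_subset by (rule inj_on_subset)
  show "real_crossings D' = f ` real_crossings D"
    using data by (auto simp: real_crossings_def w)
  show "rot D' (f c) = rot D c \<and> kind D' (f c) = kind D c" if "c \<in> real_crossings D" for c
    using that data real_crossings_subset by blast
  have "passage (word D') (f c) u = passage (word D) c u" if c: "c \<in> set (word D)" for c u
  proof -
    note 2 = count_word[OF c]
    have "passage (word D') (f c) u
        = (if u then passage (word D) c True else passage (word D) c False)"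
    proof (rule passage_eqI')
      show "count_list (word D') (f c) = 2" using c inj by (simp add: w count_word count_list_inj_map)
    qed (simp_all add: w passage_nth[OF 2] occurrences_twice(2)[OF 2])
    then show ?thesis by simp
  qed
  then show "arc_side (word D') (f c) (f e) u = arc_side (word D) c e u"
    if "c \<in> real_crossings D" "e \<in> real_crossings D" for c e u
    using that real_crossings_subset[of D] by (simp add: arc_side_def subset_iff)
qed

lemma arc_side_subword:
  assumes "word D = filter (\<lambda>x. x \<in> set (word D)) (word D')"
    and "c \<in> set (word D)" "e \<in> set (word D)"
  shows "arc_side (word D') c e u = arc_side (word D) c e u"
proof -
  have "c \<in> set (word D')" "e \<in> set (word D')"
    using assms by (metis filter_is_subset subsetD)+
  then show ?thesis
    using arc_side_filter[of "word D'" c e "\<lambda>x. x \<in> set (word D)" u] assms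
    by (simp add: count_word)
qed

text \<open>
  Both passages of another crossing contribute an even number, because they lie either in the
  interior of the arc or outside it. For the crossing itself the two contributions cancel. Exactness of
  the division by \<open>4\<close> matters for \<open>H\<close>, which contains both \<open>\<alpha>\<^sub>i \<cdot> \<gamma>\<close> and its negative.
\<close>

lemma arc_index_dvd: 
  assumes i: "i \<in> real_crossings D"
  shows "4 dvd arc_index D i"
  unfolding arc_index_def pairing_def
proof (rule dvd_sum)
  fix e assume e: "e \<in> real_crossings D"
  have 2: "count_list (word D) i = 2" "count_list (word D) e = 2"
    using i e real_crossings_subset by (blast intro: count_word)+
  have "2 dvd arc_side (word D) i e False - arc_side (word D) i e True"
  proof (cases "i = e")
    case True
    then show ?thesis by (simp add: arc_side_self 2)
  next
    case False
    have "arc_side (word D) i e u \<in> {0, 2}" for u by (rule arc_side_other[OF 2 False])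
    from this[of True] this[of False] show ?thesis by auto
  qed
  then obtain k where k: "arc_side (word D) i e False = arc_side (word D) i e True + 2 * k"
    by (metis add.commute diff_add_cancel dvdE)
  show "4 dvd rot D e * (arc_side (word D) i e False * 2 - arc_side (word D) i e True * 2)"
    unfolding k by (simp add: algebra_simps)
qed

lemma arc_pairing_flip: "arc_pairing D j i = - arc_pairing D i j"
  unfolding arc_pairing_def by (rule pairing_flip)

text \<open>
  First moves: the arc of the new crossing is null-homologous, so that all terms that involve it
  vanish.
\<close>

lemma double_sum_remove_trivial:
  assumes real: "real_crossings D' = insert c (real_crossings D)" and c: "c \<notin> real_crossings D"
    and data: "\<And>e. e \<in> real_crossings D \<Longrightarrow> rot D' e = rot D e \<and> kind D' e = kind D e"
    and pairing: "\<And>i j. \<lbrakk>i \<in> real_crossings D; j \<in> real_crossings D\<rbrakk>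
      \<Longrightarrow> arc_pairing D' i j = arc_pairing D i j"
    and index: "\<And>i. i \<in> real_crossings D \<Longrightarrow> arc_index D' i = arc_index D i"
    and trivial: "\<And>j. j \<in> real_crossings D' \<Longrightarrow> arc_pairing D' c j = 0" "arc_index D' c = 0"
    and \<Phi>: "\<And>u. 4 dvd u \<Longrightarrow> \<Phi> 0 0 u = 0" "\<And>u. 4 dvd u \<Longrightarrow> \<Phi> 0 u 0 = 0"
  shows "double_sum \<Phi> a b D' = double_sum \<Phi> a b D"
proof -
  let ?t = "\<lambda>D i j. of_int (crossing_sign D i * crossing_sign D j)
          * \<Phi> (arc_pairing D i j) (arc_index D i) (arc_index D j)"
  have sub: "crossings_of_type D a \<subseteq> crossings_of_type D' a" for a
    using data by (auto simp: crossings_of_type_def crossing_type_def real)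
  have diff: "i = c" if "i \<in> crossings_of_type D' a - crossings_of_type D a" for i a
    using that data by (auto simp: crossings_of_type_def crossing_type_def real)
  have zero: "?t D' c j = 0" "?t D' j c = 0" if "j \<in> real_crossings D'" for j
    using that trivial \<Phi> arc_index_dvd[OF that] by (simp_all add: arc_pairing_flip[of D' j c])
  have "double_sum \<Phi> a b D'
      = (\<Sum>i\<in>crossings_of_type D a. \<Sum>j\<in>crossings_of_type D' b. ?t D' i j)"
    unfolding double_sum_def
  proof (intro sum.mono_neutral_right ballI finite_crossings_of_type sub)
    fix i assume "i \<in> crossings_of_type D' a - crossings_of_type D a"
    then have i: "i = c" by (rule diff)
    show "(\<Sum>j\<in>crossings_of_type D' b. ?t D' i j) = 0"
      unfolding i by (intro sum.neutral ballI zero(1) crossings_of_type_real)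
  qed
  also have "\<dots> = (\<Sum>i\<in>crossings_of_type D a. \<Sum>j\<in>crossings_of_type D b. ?t D' i j)"
  proof (rule sum.cong[OF refl])
    fix i assume "i \<in> crossings_of_type D a"
    then have i: "i \<in> real_crossings D'" by (simp add: crossings_of_type_real real)
    show "(\<Sum>j\<in>crossings_of_type D' b. ?t D' i j) = (\<Sum>j\<in>crossings_of_type D b. ?t D' i j)"
    proof (intro sum.mono_neutral_right ballI finite_crossings_of_type sub)
      fix j assume "j \<in> crossings_of_type D' b - crossings_of_type D b"
      then have "j = c" by (rule diff)
      then show "?t D' i j = 0" using zero(2)[OF i] by (simp only:)
    qed
  qed
  also have "\<dots> = double_sum \<Phi> a b D"
    unfolding double_sum_def
    by (intro sum.cong refl) (simp add: crossings_of_type_real crossing_sign_def data pairing index)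
  finally show ?thesis .
qed

lemma sum_insert_opposite:
  fixes h :: "'b \<Rightarrow> 'a::ab_group_add"
  assumes "finite A" "c \<notin> A" "d \<notin> A" "c \<noteq> d" "h d = - h c"
  shows "sum h (insert c (insert d A)) = sum h A"
  using assms by simp

text \<open>
  Second moves: the arcs of the two new crossings are homologous, the types agree and the signs are
  opposite, so that the terms of the two crossings cancel.
\<close>

lemma double_sum_cancel_pair:
  assumes real: "real_crossings D' = insert c (insert d (real_crossings D))"
    and new: "c \<notin> real_crossings D" "d \<notin> real_crossings D" "c \<noteq> d"
    and data: "\<And>e. e \<in> real_crossings D \<Longrightarrow> rot D' e = rot D e \<and> kind D' e = kind D e"
    and pairing: "\<And>i j. \<lbrakk>i \<in> real_crossings D; j \<in> real_crossings D\<rbrakk>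
      \<Longrightarrow> arc_pairing D' i j = arc_pairing D i j"
    and index: "\<And>i. i \<in> real_crossings D \<Longrightarrow> arc_index D' i = arc_index D i"
    and homologous: "\<And>j. j \<in> real_crossings D' \<Longrightarrow> arc_pairing D' d j = arc_pairing D' c j"
      "arc_index D' d = arc_index D' c"
    and opposite: "kind D' d = kind D' c" "rot D' d = - rot D' c"
  shows "double_sum \<Phi> a b D' = double_sum \<Phi> a b D"
proof -
  let ?t = "\<lambda>D i j. of_int (crossing_sign D i * crossing_sign D j)
          * \<Phi> (arc_pairing D i j) (arc_index D i) (arc_index D j)"
  have type: "crossings_of_type D' a = (if crossing_type D' c = a
      then insert c (insert d (crossings_of_type D a)) else crossings_of_type D a)" for a
    using data opposite(1) by (auto simp: crossings_of_type_def crossing_type_def real)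
  have new': "c \<notin> crossings_of_type D a" "d \<notin> crossings_of_type D a" for a
    using new by (auto simp: crossings_of_type_def)
  have sign: "crossing_sign D' d = - crossing_sign D' c"
    using opposite by (simp add: crossing_sign_def)
  have right: "?t D' i d = - ?t D' i c" if "i \<in> real_crossings D'" for i
    using homologous(1)[OF that] homologous(2) sign
    by (simp add: arc_pairing_flip[of D' i d] arc_pairing_flip[of D' i c])
  have left: "?t D' d j = - ?t D' c j" if "j \<in> real_crossings D'" for j
    using homologous(1)[OF that] homologous(2) sign by simp
  have inner: "(\<Sum>j\<in>crossings_of_type D' b. ?t D' i j) = (\<Sum>j\<in>crossings_of_type D b. ?t D' i j)"
    if "i \<in> real_crossings D'" for i
  proof (cases "crossing_type D' c = b")
    case True
    then show ?thesis
      unfolding type[of b] if_P[OF True]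
      by (intro sum_insert_opposite) (use new new' right[OF that] in auto)
  qed (simp add: type[of b])
  have outer: "(\<Sum>j\<in>crossings_of_type D b. ?t D' d j) = - (\<Sum>j\<in>crossings_of_type D b. ?t D' c j)"
    unfolding sum_negf[symmetric] by (intro sum.cong refl left) (simp add: real crossings_of_type_real)
  have "double_sum \<Phi> a b D'
      = (\<Sum>i\<in>crossings_of_type D' a. \<Sum>j\<in>crossings_of_type D b. ?t D' i j)"
    unfolding double_sum_def by (intro sum.cong refl inner) (simp add: crossings_of_type_real)
  also have "\<dots> = (\<Sum>i\<in>crossings_of_type D a. \<Sum>j\<in>crossings_of_type D b. ?t D' i j)"
  proof (cases "crossing_type D' c = a")
    case True
    then show ?thesis
      unfolding type[of a] if_P[OF True]
      by (intro sum_insert_opposite) (use new new' outer in auto)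
  qed (simp add: type[of a])
  also have "\<dots> = double_sum \<Phi> a b D"
    unfolding double_sum_def
    by (intro sum.cong refl) (simp add: crossings_of_type_real crossing_sign_def data pairing index)
  finally show ?thesis .
qed

lemma pairing_insert:
  assumes "finite S" "c \<notin> S"
  shows "pairing r (insert c S) x y
    = r c * (x c False * y c True - x c True * y c False) + pairing r S x y"
  using assms by (simp add: pairing_def)

text \<open>
  The two passages of the new crossing are adjacent. So every other arc contains both or none of
  them, and the new arc contains no other passage.
\<close>

lemma double_sum_first_move:
  assumes w: "word D = A @ B" "word D' = A @ [c, c] @ B"
    and same: "same_crossings (set (word D)) D D'"
    and \<Phi>: "\<And>u. 4 dvd u \<Longrightarrow> \<Phi> 0 0 u = 0" "\<And>u. 4 dvd u \<Longrightarrow> \<Phi> 0 u 0 = 0"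
  shows "double_sum \<Phi> a b D' = double_sum \<Phi> a b D"
proof -
  let ?w = "word D" and ?w' = "word D'" and ?S = "real_crossings D"
  have 2: "count_list ?w' e = 2" if "e \<in> set ?w'" for e using that by (rule count_word)
  have c2: "count_list ?w' c = 2" by (rule 2) (simp add: w)
  then have c: "c \<notin> set ?w" by (simp add: w count_list_0_iff)
  have sub: "?w = filter (\<lambda>x. x \<in> set ?w) ?w'" using c by (simp add: w)
  have data: "rot D' e = rot D e \<and> kind D' e = kind D e" if "e \<in> ?S" for e
    using same that real_crossings_subset by (auto simp: same_crossings_def)
  have S: "e \<in> set ?w" "e \<in> set ?w'" "e \<noteq> c" if "e \<in> ?S" for e
    using that real_crossings_subset[of D] c by (auto simp: w)
  have side: "arc_side ?w' i e u = arc_side ?w i e u" if "i \<in> ?S" "e \<in> ?S" for i e u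
    using that S by (intro arc_side_subword[OF sub]) auto
  have real: "real_crossings D' = (if kind D' c = Virtual then ?S else insert c ?S)"
    using same by (auto simp: real_crossings_def same_crossings_def w)
  show ?thesis
  proof (cases "kind D' c = Virtual")
    case True
    show ?thesis
      by (rule double_sum_same_crossings) (use True real data side in auto)
  next
    case False
    then have real: "real_crossings D' = insert c ?S" using real by simp
    have Pc: "passage ?w' c u = length A + of_bool u" for u
      by (subst passage_eqI'[OF c2, of "length A" "length A + 1"]) (auto simp: w nth_append)
    have ne: "passage ?w' e u \<noteq> length A + of_bool v" if "e \<in> ?S" for e u v
      unfolding Pc[symmetric] using S[OF that] by (simp add: passage_inj 2 c2)
    have ne': "passage ?w' e u \<noteq> length A" "passage ?w' e u \<noteq> length A + 1" if "e \<in> ?S" for e u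
      using ne[OF that, of u False] ne[OF that, of u True] by auto
    have new: "arc_side ?w' c e u = 0" if "e \<in> ?S" for e u
      using ne'[OF that, of u] by (auto simp: arc_side_def Pc sgn_if)
    have old: "arc_side ?w' i c u = arc_side ?w' i c False" if "i \<in> ?S" for i u
      using ne'[OF that, of True] ne'[OF that, of False] by (cases u) (auto simp: arc_side_def Pc sgn_if)
    have self: "arc_side ?w' c c u = 1" for u by (rule arc_side_self[OF c2])
    have cS: "c \<notin> ?S" using S by blast
    note ins = pairing_insert[OF finite_real_crossings cS]
    show ?thesis
    proof (rule double_sum_remove_trivial[where \<Phi> = \<Phi>, OF real cS data _ _ _ _ \<Phi>])
      show "arc_pairing D' i j = arc_pairing D i j" if "i \<in> ?S" "j \<in> ?S" for i j
        unfolding arc_pairing_def real ins old[OF that(1), of True] old[OF that(2), of True]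
        using that by (simp add: data side cong: pairing_cong)
      show "arc_index D' i = arc_index D i" if "i \<in> ?S" for i
        unfolding arc_index_def real ins old[OF that(1), of True]
        using that by (simp add: data side cong: pairing_cong)
      have zero: "pairing (rot D') ?S (arc_side ?w' c) y = 0" for y
        by (simp add: pairing_def new)
      show "arc_index D' c = 0"
        unfolding arc_index_def real ins by (simp add: zero self)
      show "arc_pairing D' c j = 0" if "j \<in> real_crossings D'" for j
        using that unfolding arc_pairing_def real ins by (auto simp: zero self old[of _ True])
    qed
  qed
qed

text \<open>
  The first passages of the two new crossings are adjacent, and so are the second ones. No other
  passage separates the two new arcs; they differ only at the new crossings, and there the
  two contributions compensate because the tangent frames are opposite.
\<close>

lemma double_sum_second_move:
  assumes w: "word D = A @ B @ C"
      "word D' = A @ [c, d] @ B @ [c, d] @ C \<or> word D' = A @ [c, d] @ B @ [d, c] @ C"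
    and same: "same_crossings (set (word D)) D D'"
    and kind: "kind D' c = kind D' d" and rot: "rot D' c = - rot D' d"
  shows "double_sum \<Phi> a b D' = double_sum \<Phi> a b D"
proof -
  let ?w = "word D" and ?w' = "word D'" and ?S = "real_crossings D"
  let ?p = "length A" and ?q = "length A + 2 + length B"
  have 2: "count_list ?w' e = 2" if "e \<in> set ?w'" for e using that by (rule count_word)
  have cd: "c \<in> set ?w'" "d \<in> set ?w'" using w(2) by auto
  have "c \<noteq> d" using rot rot_sign[OF cd(1)] by auto
  have new: "c \<notin> set ?w" "d \<notin> set ?w"
    using 2[OF cd(1)] 2[OF cd(2)] w \<open>c \<noteq> d\<close> by (auto simp: count_list_0_iff)
  have sub: "?w = filter (\<lambda>x. x \<in> set ?w) ?w'" using new w by auto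
  have data: "rot D' e = rot D e \<and> kind D' e = kind D e" if "e \<in> ?S" for e
    using same that real_crossings_subset by (auto simp: same_crossings_def)
  have S: "e \<in> set ?w" "e \<in> set ?w'" "e \<noteq> c" "e \<noteq> d" if "e \<in> ?S" for e
    using that real_crossings_subset[of D] new w by auto
  have side: "arc_side ?w' i e u = arc_side ?w i e u" if "i \<in> ?S" "e \<in> ?S" for i e u
    using that S by (intro arc_side_subword[OF sub]) auto
  have set: "set ?w' = {c, d} \<union> set ?w" using w by auto
  have real: "real_crossings D' = (if kind D' c = Virtual then ?S else insert c (insert d ?S))"
    using same kind by (auto simp: real_crossings_def same_crossings_def set)
  show ?thesis
  proof (cases "kind D' c = Virtual")
    case True
    show ?thesis
      by (rule double_sum_same_crossings) (use True real data side in auto)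
  next
    case False
    then have real: "real_crossings D' = insert c (insert d ?S)" using real by simp
\<comment> \<open>The flag tells which of the two admissible orders occurs on the second strand.\<close>

    obtain s :: bool where P: "passage ?w' c False = ?p" "passage ?w' c True = ?q + of_bool (\<not> s)"
      "passage ?w' d False = ?p + 1" "passage ?w' d True = ?q + of_bool s"
    proof (cases "?w' = A @ [c, d] @ B @ [c, d] @ C")
      case True
      have nth: "?w' ! ?p = c" "?w' ! (?p + 1) = d" "?w' ! ?q = c" "?w' ! (?q + 1) = d"
        "?q + 1 < length ?w'"
        by (simp_all add: True nth_append)
      show ?thesis
        by (rule that[of True])
          (use passage_eqI'[OF 2[OF cd(1)] nth(1) nth(3)]
               passage_eqI'[OF 2[OF cd(2)] nth(2) nth(4)] nth(5) in auto)
    next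
      case False
      then have w': "?w' = A @ [c, d] @ B @ [d, c] @ C" using w by blast
      have nth: "?w' ! ?p = c" "?w' ! (?p + 1) = d" "?w' ! ?q = d" "?w' ! (?q + 1) = c"
        "?q + 1 < length ?w'"
        by (simp_all add: w' nth_append)
      show ?thesis
        by (rule that[of False])
          (use passage_eqI'[OF 2[OF cd(1)] nth(1) nth(4)]
               passage_eqI'[OF 2[OF cd(2)] nth(2) nth(3)] nth(5) in auto)
    qed
    have ne: "passage ?w' e u \<notin> {?p, ?p + 1, ?q, ?q + 1}" if "e \<in> ?S" for e u
    proof -
      have "passage ?w' e u \<noteq> passage ?w' c v" "passage ?w' e u \<noteq> passage ?w' d v" for v
        using that S cd by (simp_all add: passage_inj 2)
      from this[of True] this[of False] show ?thesis by (cases s) (auto simp: P)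
    qed
    have parallel: "arc_side ?w' d e u = arc_side ?w' c e u" if "e \<in> ?S" for e u
      using ne[OF that, of u] by (cases s) (auto simp: arc_side_def P sgn_if)
    have old: "arc_side ?w' i d u = arc_side ?w' i c u" if "i \<in> ?S" for i u
      using ne[OF that, of True] ne[OF that, of False]
      by (cases s; cases u) (auto simp: arc_side_def P sgn_if)
    have self: "arc_side ?w' c c u = 1" "arc_side ?w' d d u = 1" for u
      using cd by (simp_all add: arc_side_self 2)
    have cross: "arc_side ?w' c d False = 2" "arc_side ?w' c d True = 2 * of_bool (\<not> s)"
      "arc_side ?w' d c False = 0" "arc_side ?w' d c True = 2 * of_bool s"
      by (simp_all add: arc_side_def P sgn_if)
    have cS: "c \<notin> insert d ?S" and dS: "d \<notin> ?S" using S \<open>c \<noteq> d\<close> by blast+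
    have "finite (insert d ?S)" by simp
    note ins = pairing_insert[OF this cS] pairing_insert[OF finite_real_crossings dS]
    show ?thesis
    proof (rule double_sum_cancel_pair[OF real _ dS \<open>c \<noteq> d\<close> data])
      show "c \<notin> ?S" using cS by blast
      show "arc_pairing D' i j = arc_pairing D i j" if "i \<in> ?S" "j \<in> ?S" for i j
        unfolding arc_pairing_def real ins rot old[OF that(1)] old[OF that(2)]
        using that by (simp add: data side cong: pairing_cong)
      show "arc_index D' i = arc_index D i" if "i \<in> ?S" for i
        unfolding arc_index_def real ins rot old[OF that(1)]
        using that by (simp add: data side cong: pairing_cong)
      have par: "pairing (rot D') ?S (arc_side ?w' d) y = pairing (rot D') ?S (arc_side ?w' c) y" for y
        by (simp add: pairing_def parallel)
      have par': "pairing (rot D') ?S x (arc_side ?w' d) = pairing (rot D') ?S x (arc_side ?w' c)" for x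
        by (simp add: pairing_def parallel)
      show "arc_index D' d = arc_index D' c"
        unfolding arc_index_def real ins par
        by (simp add: self cross rot algebra_simps)
      show "arc_pairing D' d j = arc_pairing D' c j" if j: "j \<in> real_crossings D'" for j
      proof -
        consider "j = c" | "j = d" | "j \<in> ?S" using j unfolding real by blast
        then show ?thesis
          unfolding arc_pairing_def real ins par par'
          by cases (simp_all add: par par' self cross rot old algebra_simps)
      qed
      show "kind D' d = kind D' c" "rot D' d = - rot D' c" using kind rot by simp_all
    qed
  qed
qed

section \<open>Third moves\<close>

definition plus_minus :: "bool \<Rightarrow> int" where
  "plus_minus b = (if b then 1 else - 1)"

lemma face_closed:
  assumes "f \<in> faces w r" "d \<in> f"
  shows "next_dart w r d \<in> f"
  using assms by (auto simp: faces_def intro: orbit.step)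

text \<open>
  Consider three straight lines through the vertices of a triangle, directed as the strands. Let
  \<open>o1\<close> say that strand 1 meets strand 2 before strand 3, and similarly \<open>o2\<close>, \<open>o3\<close> (the smaller
  number first). Each tangent is the corresponding side of the triangle up to the sign
  \<open>o\<^sub>i\<close>, and the frame at each vertex has the orientation of the triangle up to the signs of its two
  strands. Hence the three products below all equal the orientation of the triangle. The proof
  walks around the face: arriving at a vertex on strand \<open>i\<close>, the face must continue on the edge of the
  triangle on the other strand, and whether that edge is then followed forward or backward
  tells both the turning direction and the order of the two vertices on it.
\<close>

lemma triangle_signs:
  fixes r :: "nat \<Rightarrow> int"
  assumes tri: "triangle w r (Suc m1) (Suc m2) (Suc m3)"
    and m: "Suc m1 < m2" "Suc m2 < m3" "Suc m3 < length w"
    and r: "\<And>c. c \<in> {c12, c13, c23} \<Longrightarrow> r c \<in> {1, - 1}"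
    and P: "passage w c12 False = m1 + of_bool (\<not> o1)" "passage w c13 False = m1 + of_bool o1"
      "passage w c12 True = m2 + of_bool (\<not> o2)" "passage w c23 False = m2 + of_bool o2"
      "passage w c13 True = m3 + of_bool (\<not> o3)" "passage w c23 True = m3 + of_bool o3"
    and nth: "\<And>c u. c \<in> {c12, c13, c23} \<Longrightarrow> w ! passage w c u = c"
  shows "r c12 * plus_minus o1 * plus_minus o2 = r c13 * plus_minus o1 * plus_minus o3"
    and "r c23 * plus_minus o2 * plus_minus o3 = r c13 * plus_minus o1 * plus_minus o3"
proof -
  obtain f where f: "f \<in> faces w r" "card f = 3" "fst ` f = {Suc m1, Suc m2, Suc m3}"
    using tri by (auto simp: triangle_def)
  have "card (fst ` f) = card f" unfolding f using m by simp
  moreover have "finite f" using f(2) by (simp add: card_ge_0_finite)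
  ultimately have inj: "inj_on fst f" by (simp add: eq_card_imp_inj_on)
  have "Suc m1 \<in> fst ` f" "Suc m2 \<in> fst ` f" "Suc m3 \<in> fst ` f" using f(3) by auto
  then obtain b1 b2 b3 where b: "(Suc m1, b1) \<in> f" "(Suc m2, b2) \<in> f" "(Suc m3, b3) \<in> f" by force
  have mem: "k = Suc m1 \<and> v = b1 \<or> k = Suc m2 \<and> v = b2 \<or> k = Suc m3 \<and> v = b3"
    if "(k, v) \<in> f" for k v
  proof -
    have "k \<in> fst ` f" using that by force
    then have k: "k = Suc m1 \<or> k = Suc m2 \<or> k = Suc m3" using f(3) by auto
    have "v = v'" if "(k, v') \<in> f" for v'
      using inj_onD[OF inj, of "(k, v)" "(k, v')"] that \<open>(k, v) \<in> f\<close> by simp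
    then show ?thesis using k b by auto
  qed
  have F: "first_pos w c12 = m1 + of_bool (\<not> o1)" "first_pos w c13 = m1 + of_bool o1"
      "second_pos w c12 = m2 + of_bool (\<not> o2)" "first_pos w c23 = m2 + of_bool o2"
      "second_pos w c13 = m3 + of_bool (\<not> o3)" "second_pos w c23 = m3 + of_bool o3"
    using P by (simp_all add: passage_def)
  have N: "w ! (m1 + of_bool (\<not> o1)) = c12" "w ! (m1 + of_bool o1) = c13"
    "w ! (m2 + of_bool (\<not> o2)) = c12" "w ! (m2 + of_bool o2) = c23"
    "w ! (m3 + of_bool (\<not> o3)) = c13" "w ! (m3 + of_bool o3) = c23"
    using nth[of c12 False] nth[of c12 True] nth[of c13 False] nth[of c13 True]
      nth[of c23 False] nth[of c23 True] by (simp_all add: P)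
\<comment> \<open>A dart \<open>(Suc m, v)\<close> arrives at passage \<open>m + 1\<close> if it runs forward and at \<open>m\<close> otherwise.\<close>

  have turn: "(other_pos w (m + of_bool v) + of_bool (crossing_dir w r (m + of_bool v) = plus_minus v),
      crossing_dir w r (m + of_bool v) = plus_minus v) \<in> f"
    if "(Suc m, v) \<in> f" "Suc m < length w" for m v
    using face_closed[OF f(1) that(1)] that(2) by (cases v) (auto simp: plus_minus_def split: if_splits)
\<comment> \<open>Leaving passage \<open>m + z\<close> in direction \<open>x\<close>, one stays in the triangle only on the edge \<open>m + 1\<close>.\<close>

  have land1: "x = (\<not> z) \<and> b1 = x" if "(m1 + of_bool z + of_bool x, x) \<in> f" for x z
    using mem[OF that] m by (cases z; cases x) auto
  have land2: "x = (\<not> z) \<and> b2 = x" if "(m2 + of_bool z + of_bool x, x) \<in> f" for x z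
    using mem[OF that] m by (cases z; cases x) auto
  have land3: "x = (\<not> z) \<and> b3 = x" if "(m3 + of_bool z + of_bool x, x) \<in> f" for x z
    using mem[OF that] m by (cases z; cases x) auto
  have ne: "m1 + of_bool x \<noteq> m2 + of_bool y" "m2 + of_bool x \<noteq> m1 + of_bool y"
    "m1 + of_bool x \<noteq> m3 + of_bool y" "m3 + of_bool x \<noteq> m1 + of_bool y"
    "m2 + of_bool x \<noteq> m3 + of_bool y" "m3 + of_bool x \<noteq> m2 + of_bool y" for x y
    using m by (cases x; cases y; simp)+
  have dir: "crossing_dir w r (m1 + of_bool (\<not> o1)) = r c12" "crossing_dir w r (m1 + of_bool o1) = r c13"
    "crossing_dir w r (m2 + of_bool (\<not> o2)) = - r c12" "crossing_dir w r (m2 + of_bool o2) = r c23"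
    "crossing_dir w r (m3 + of_bool (\<not> o3)) = - r c13" "crossing_dir w r (m3 + of_bool o3) = - r c23"
    unfolding crossing_dir_def N F using ne by (simp_all del: of_bool_not_iff)
  have other: "other_pos w (m1 + of_bool (\<not> o1)) = m2 + of_bool (\<not> o2)"
    "other_pos w (m1 + of_bool o1) = m3 + of_bool (\<not> o3)"
    "other_pos w (m2 + of_bool (\<not> o2)) = m1 + of_bool (\<not> o1)"
    "other_pos w (m2 + of_bool o2) = m3 + of_bool o3"
    "other_pos w (m3 + of_bool (\<not> o3)) = m1 + of_bool o1"
    "other_pos w (m3 + of_bool o3) = m2 + of_bool o2"
    unfolding other_pos_def N F using ne by (simp_all del: of_bool_not_iff)
  have 1: "if b1 = (\<not> o1) then (r c12 = plus_minus b1) = o2 \<and> b2 = o2 else (r c13 = plus_minus b1) = o3 \<and> b3 = o3"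
  proof (cases "b1 = (\<not> o1)")
    case True
    then show ?thesis using turn[OF b(1)] m land2[of "\<not> o2"] by (simp add: dir other del: of_bool_not_iff)
  next
    case False
    then have "b1 = o1" by simp
    then show ?thesis using turn[OF b(1)] m land3[of "\<not> o3"] by (simp add: dir other del: of_bool_not_iff)
  qed
  have 2: "if b2 = (\<not> o2) then (- r c12 = plus_minus b2) = o1 \<and> b1 = o1 else (r c23 = plus_minus b2) = (\<not> o3) \<and> b3 = (\<not> o3)"
  proof (cases "b2 = (\<not> o2)")
    case True
    then show ?thesis using turn[OF b(2)] m land1[of "\<not> o1"] by (simp add: dir other del: of_bool_not_iff)
  next
    case False
    then have "b2 = o2" by simp
    then show ?thesis using turn[OF b(2)] m land3[of "o3"] by (simp add: dir other del: of_bool_not_iff)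
  qed
  have 3: "if b3 = (\<not> o3) then (- r c13 = plus_minus b3) = (\<not> o1) \<and> b1 = (\<not> o1)
      else (- r c23 = plus_minus b3) = (\<not> o2) \<and> b2 = (\<not> o2)"
  proof (cases "b3 = (\<not> o3)")
    case True
    then show ?thesis using turn[OF b(3)] m land1[of "o1"] by (simp add: dir other del: of_bool_not_iff)
  next
    case False
    then have "b3 = o3" by simp
    then show ?thesis using turn[OF b(3)] m land2[of "o2"] by (simp add: dir other del: of_bool_not_iff)
  qed
  have "r c12 \<in> {1, - 1}" "r c13 \<in> {1, - 1}" "r c23 \<in> {1, - 1}"
    using r by simp_all
  then have "r c12 * plus_minus o1 * plus_minus o2 = r c13 * plus_minus o1 * plus_minus o3 \<and> r c23 * plus_minus o2 * plus_minus o3 = r c13 * plus_minus o1 * plus_minus o3"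
    using 1 2 3 by (cases o1; cases o2; cases o3; cases b1; cases b2; cases b3) (auto simp: plus_minus_def)
  then show "r c12 * plus_minus o1 * plus_minus o2 = r c13 * plus_minus o1 * plus_minus o3"
    and "r c23 * plus_minus o2 * plus_minus o3 = r c13 * plus_minus o1 * plus_minus o3" by blast+
qed

lemma third_passages:
  assumes w: "word D = A @ [x1, x2] @ B @ [y1, y2] @ C @ [z1, z2] @ E"
    and sets: "{x1, x2} = {c12, c13}" "{y1, y2} = {c12, c23}" "{z1, z2} = {c13, c23}"
    and m: "m1 = length A" "m2 = length A + length B + 2" "m3 = length A + length B + length C + 4"
  shows "distinct [c12, c13, c23]"
    and "passage (word D) c12 False = m1 + of_bool (x1 \<noteq> c12)"
      "passage (word D) c13 False = m1 + of_bool (x1 = c12)"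
      "passage (word D) c12 True = m2 + of_bool (y1 \<noteq> c12)"
      "passage (word D) c23 False = m2 + of_bool (y1 = c12)"
      "passage (word D) c13 True = m3 + of_bool (z1 \<noteq> c13)"
      "passage (word D) c23 True = m3 + of_bool (z1 = c13)"
proof -
  have 2: "count_list (word D) c = 2" if "c \<in> {c12, c13, c23}" for c
    using that w sets by (intro count_word) (auto simp: doubleton_eq_iff)
  have x: "x1 = c12 \<and> x2 = c13 \<or> x1 = c13 \<and> x2 = c12"
    and y: "y1 = c12 \<and> y2 = c23 \<or> y1 = c23 \<and> y2 = c12"
    and z: "z1 = c13 \<and> z2 = c23 \<or> z1 = c23 \<and> z2 = c13"
    using sets by (auto simp: doubleton_eq_iff)
  have "count_list (word D) c \<ge> count_list [x1, x2] c + count_list [y1, y2] c + count_list [z1, z2] c" for c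
    by (simp add: w)
  then have le: "count_list [x1, x2] c + count_list [y1, y2] c + count_list [z1, z2] c \<le> 2"
    if "c \<in> {c12, c13, c23}" for c
    using 2[OF that] by (metis (no_types))
  show distinct: "distinct [c12, c13, c23]"
    using x y z le[of c12] le[of c13] le[of c23] by (auto split: if_splits)
  have nth: "word D ! m1 = x1" "word D ! (m1 + 1) = x2" "word D ! m2 = y1" "word D ! (m2 + 1) = y2"
    "word D ! m3 = z1" "word D ! (m3 + 1) = z2" "m1 + 1 < m2" "m2 + 1 < m3" "m3 + 1 < length (word D)"
    by (simp_all add: w m nth_append)
  have X: "word D ! (m1 + of_bool (x1 \<noteq> c12)) = c12" "word D ! (m1 + of_bool (x1 = c12)) = c13"
    using x nth(1,2) distinct by (cases "x1 = c12"; simp)+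
  have Y: "word D ! (m2 + of_bool (y1 \<noteq> c12)) = c12" "word D ! (m2 + of_bool (y1 = c12)) = c23"
    using y nth(3,4) distinct by (cases "y1 = c12"; simp)+
  have Z: "word D ! (m3 + of_bool (z1 \<noteq> c13)) = c13" "word D ! (m3 + of_bool (z1 = c13)) = c23"
    using z nth(5,6) distinct by (cases "z1 = c13"; simp)+
  have order: "m1 + of_bool b < m2 + of_bool b'" "m1 + of_bool b < m3 + of_bool b'"
    "m2 + of_bool b < m3 + of_bool b'" "m2 + of_bool b < length (word D)"
    "m3 + of_bool b < length (word D)" for b b'
    using nth(7-9) by (cases b; cases b'; simp)+
  have P12: "passage (word D) c12 u = (if u then m2 + of_bool (y1 \<noteq> c12) else m1 + of_bool (x1 \<noteq> c12))" for u
    by (rule passage_eqI'[OF 2 X(1) Y(1) order(1,4)]) simp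
  have P13: "passage (word D) c13 u = (if u then m3 + of_bool (z1 \<noteq> c13) else m1 + of_bool (x1 = c12))" for u
    by (rule passage_eqI'[OF 2 X(2) Z(1) order(2,5)]) simp
  have P23: "passage (word D) c23 u = (if u then m3 + of_bool (z1 = c13) else m2 + of_bool (y1 = c12))" for u
    by (rule passage_eqI'[OF 2 Y(2) Z(2) order(3,5)]) simp
  show "passage (word D) c12 False = m1 + of_bool (x1 \<noteq> c12)"
      "passage (word D) c13 False = m1 + of_bool (x1 = c12)"
      "passage (word D) c12 True = m2 + of_bool (y1 \<noteq> c12)"
      "passage (word D) c23 False = m2 + of_bool (y1 = c12)"
      "passage (word D) c13 True = m3 + of_bool (z1 \<noteq> c13)"
      "passage (word D) c23 True = m3 + of_bool (z1 = c13)"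
    by (simp_all add: P12 P13 P23)
qed

lemma triple_sides:
  assumes P: "passage w c12 False = m1 + of_bool (\<not> o1)" "passage w c13 False = m1 + of_bool o1"
      "passage w c12 True = m2 + of_bool (\<not> o2)" "passage w c23 False = m2 + of_bool o2"
      "passage w c13 True = m3 + of_bool (\<not> o3)" "passage w c23 True = m3 + of_bool o3"
    and m: "m1 + 1 < m2" "m2 + 1 < m3"
  shows "arc_side w c12 c12 u = 1" "arc_side w c12 c13 False = 1 + plus_minus o1" "arc_side w c12 c13 True = 0"
      "arc_side w c12 c23 False = 1 - plus_minus o2" "arc_side w c12 c23 True = 0"
    and "arc_side w c13 c13 u = 1" "arc_side w c13 c12 False = 1 - plus_minus o1" "arc_side w c13 c12 True = 2"
      "arc_side w c13 c23 False = 2" "arc_side w c13 c23 True = 1 - plus_minus o3"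
    and "arc_side w c23 c23 u = 1" "arc_side w c23 c12 False = 0" "arc_side w c23 c12 True = 1 - plus_minus o2"
      "arc_side w c23 c13 False = 0" "arc_side w c23 c13 True = 1 + plus_minus o3"
proof -
  show "arc_side w c12 c12 u = 1" "arc_side w c13 c13 u = 1" "arc_side w c23 c23 u = 1"
    using m by (cases u; cases o1; cases o2; cases o3; simp add: arc_side_def P)+
  show "arc_side w c12 c13 False = 1 + plus_minus o1" "arc_side w c13 c12 False = 1 - plus_minus o1"
    using m by (cases o1; cases o2; cases o3; simp add: arc_side_def P plus_minus_def)+
  show "arc_side w c12 c23 False = 1 - plus_minus o2" "arc_side w c23 c12 True = 1 - plus_minus o2"
    using m by (cases o1; cases o2; cases o3; simp add: arc_side_def P plus_minus_def)+
  show "arc_side w c13 c23 True = 1 - plus_minus o3" "arc_side w c23 c13 True = 1 + plus_minus o3"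
    using m by (cases o1; cases o2; cases o3; simp add: arc_side_def P plus_minus_def)+
  show "arc_side w c12 c13 True = 0" "arc_side w c12 c23 True = 0" "arc_side w c13 c12 True = 2"
    "arc_side w c13 c23 False = 2" "arc_side w c23 c12 False = 0" "arc_side w c23 c13 False = 0"
    using m by (cases o1; cases o2; cases o3; simp add: arc_side_def P plus_minus_def)+
qed

text \<open>
  How a third move changes a cycle at the six passages of the triangle, listed as first and
  second passage of \<open>c12\<close>, of \<open>c13\<close> and of \<open>c23\<close>. The order of the two passages on each strand is
  reversed, so the signs \<open>o1\<close>, \<open>o2\<close>, \<open>o3\<close> change. A cycle that does not start at the
  triangle takes one value on each strand and is unaffected; the other cases are the arcs of the
  three crossings.
\<close>

inductive triangle_flip ::
  "int \<Rightarrow> int \<Rightarrow> int \<Rightarrow> int \<times> int \<times> int \<times> int \<times> int \<times> int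
   \<Rightarrow> int \<times> int \<times> int \<times> int \<times> int \<times> int \<Rightarrow> bool"
  for o1 o2 o3 where
  far: "triangle_flip o1 o2 o3 (s1, s2, s1, s3, s2, s3) (s1, s2, s1, s3, s2, s3)"
| arc12: "triangle_flip o1 o2 o3 (1, 1, 1 + o1, 0, 1 - o2, 0) (1, 1, 1 - o1, 0, 1 + o2, 0)"
| arc13: "triangle_flip o1 o2 o3 (1 - o1, 2, 1, 1, 2, 1 - o3) (1 + o1, 2, 1, 1, 2, 1 + o3)"
| arc23: "triangle_flip o1 o2 o3 (0, 1 - o2, 0, 1 + o3, 1, 1) (0, 1 + o2, 0, 1 - o3, 1, 1)"

definition triangle_values_of ::
  "nat \<Rightarrow> nat \<Rightarrow> nat \<Rightarrow> (nat \<Rightarrow> bool \<Rightarrow> int) \<Rightarrow> int \<times> int \<times> int \<times> int \<times> int \<times> int" where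
  "triangle_values_of c12 c13 c23 x =
     (x c12 False, x c12 True, x c13 False, x c13 True, x c23 False, x c23 True)"

text \<open>
  The part of the pairing that comes from the triangle, up to the orientation of the triangle.
\<close>

fun triangle_form ::
  "int \<Rightarrow> int \<Rightarrow> int \<Rightarrow> int \<times> int \<times> int \<times> int \<times> int \<times> int
   \<Rightarrow> int \<times> int \<times> int \<times> int \<times> int \<times> int \<Rightarrow> int" where
  "triangle_form o1 o2 o3 (x1, x2, x3, x4, x5, x6) (y1, y2, y3, y4, y5, y6)
   = o1 * o2 * (x1 * y2 - x2 * y1) + o1 * o3 * (x3 * y4 - x4 * y3) + o2 * o3 * (x5 * y6 - x6 * y5)"

text \<open>
  A third move is a homotopy of the curve on the surface. Accordingly the changes at the three crossings
  compensate; with the signs of the triangle this is a finite computation.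
\<close>

lemma triangle_form_flip:
  assumes "triangle_flip o1 o2 o3 t t'" "triangle_flip o1 o2 o3 v v'"
    and o: "o1 = 1 \<or> o1 = - 1" "o2 = 1 \<or> o2 = - 1" "o3 = 1 \<or> o3 = - 1"
  shows "triangle_form o1 o2 o3 t v = triangle_form o1 o2 o3 t' v'"
  using assms(1)
proof cases
  case far
  note t = far
  show ?thesis
    using assms(2) o by cases (elim disjE; simp add: t algebra_simps)+
next
  case arc12
  note t = arc12
  show ?thesis
    using assms(2) o by cases (elim disjE; simp add: t algebra_simps)+
next
  case arc13
  note t = arc13
  show ?thesis
    using assms(2) o by cases (elim disjE; simp add: t algebra_simps)+
next
  case arc23
  note t = arc23
  show ?thesis
    using assms(2) o by cases (elim disjE; simp add: t algebra_simps)+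
qed

lemma pairing_triangle_flip:
  assumes "triangle_flip (plus_minus o1) (plus_minus o2) (plus_minus o3) (triangle_values_of c12 c13 c23 x) (triangle_values_of c12 c13 c23 x')"
    and "triangle_flip (plus_minus o1) (plus_minus o2) (plus_minus o3) (triangle_values_of c12 c13 c23 y) (triangle_values_of c12 c13 c23 y')"
    and r: "r c12 * plus_minus o1 * plus_minus o2 = r c13 * plus_minus o1 * plus_minus o3" "r c23 * plus_minus o2 * plus_minus o3 = r c13 * plus_minus o1 * plus_minus o3"
    and distinct: "distinct [c12, c13, c23]"
  shows "pairing r {c12, c13, c23} x y = pairing r {c12, c13, c23} x' y'"
proof -
  have sq: "plus_minus b = 1 \<or> plus_minus b = - 1" for b by (simp add: plus_minus_def)
  have "r c13 = r c12 * plus_minus o1 * plus_minus o2 * (plus_minus o1 * plus_minus o3)"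
    "r c23 = r c12 * plus_minus o1 * plus_minus o2 * (plus_minus o2 * plus_minus o3)"
    "r c12 = r c12 * plus_minus o1 * plus_minus o2 * (plus_minus o1 * plus_minus o2)"
    using r by (cases o1; cases o2; cases o3; simp add: plus_minus_def)+
  then obtain s where s: "r c12 = s * (plus_minus o1 * plus_minus o2)" "r c13 = s * (plus_minus o1 * plus_minus o3)"
    "r c23 = s * (plus_minus o2 * plus_minus o3)" by blast
  have "pairing r {c12, c13, c23} x y = s * triangle_form (plus_minus o1) (plus_minus o2) (plus_minus o3)
      (triangle_values_of c12 c13 c23 x) (triangle_values_of c12 c13 c23 y)" for x y
    using distinct by (simp add: pairing_def triangle_values_of_def s algebra_simps)
  then show ?thesis
    using triangle_form_flip[OF assms(1,2) sq sq sq] by simp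
qed

text \<open>
  With fewer than two real crossings in the triangle, no two passages of real crossings are exchanged.
\<close>

lemma third_move_real_cases:
  assumes "third_move_kinds k12 k13 k23"
  shows "k12 \<noteq> Virtual \<and> k13 \<noteq> Virtual \<and> k23 \<noteq> Virtual
    \<or> (k12 = Virtual \<or> k13 = Virtual) \<and> (k12 = Virtual \<or> k23 = Virtual) \<and> (k13 = Virtual \<or> k23 = Virtual)"
  using assms by (auto split: if_splits)

lemma double_sum_third_move:
  assumes w: "word D = A @ [x1, x2] @ B @ [y1, y2] @ C @ [z1, z2] @ E"
      "word D' = A @ [x2, x1] @ B @ [y2, y1] @ C @ [z2, z1] @ E"
    and sets: "{x1, x2} = {c12, c13}" "{y1, y2} = {c12, c23}" "{z1, z2} = {c13, c23}"
    and tri: "triangle (word D) (rot D) (length A + 1) (length A + length B + 3)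
        (length A + length B + length C + 5)"
    and same: "same_crossings (set (word D)) D D'"
    and kinds: "third_move_kinds (kind D c12) (kind D c13) (kind D c23)"
  shows "double_sum \<Phi> a b D' = double_sum \<Phi> a b D"
proof -
  let ?w = "word D" and ?w' = "word D'" and ?S = "real_crossings D" and ?T = "{c12, c13, c23}"
  define m1 where "m1 = length A"
  define m2 where "m2 = length A + length B + 2"
  define m3 where "m3 = length A + length B + length C + 4"
  note m = m1_def m2_def m3_def
  have sets': "{x2, x1} = {c12, c13}" "{y2, y1} = {c12, c23}" "{z2, z1} = {c13, c23}"
    using sets by (simp_all add: insert_commute)
  note third = third_passages[OF w(1) sets m] and third' = third_passages[OF w(2) sets' m]
  have lt: "m1 + 1 < m2" "m2 + 1 < m3" "m3 + 1 < length ?w" by (simp_all add: m w)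
  have distinct: "distinct [c12, c13, c23]" by (rule third(1))
  have flip: "x2 = c12 \<longleftrightarrow> x1 \<noteq> c12" "y2 = c12 \<longleftrightarrow> y1 \<noteq> c12" "z2 = c13 \<longleftrightarrow> z1 \<noteq> c13"
    using sets distinct by (auto simp: doubleton_eq_iff)
  define o1 where "o1 = (x1 = c12)"
  define o2 where "o2 = (y1 = c12)"
  define o3 where "o3 = (z1 = c13)"
  note P = third(2-)[folded o1_def o2_def o3_def]
  note P' = third'(2-)[unfolded flip, folded o1_def o2_def o3_def]
  have set: "set ?w' = set ?w" by (auto simp: w)
  have data: "rot D' c = rot D c \<and> kind D' c = kind D c" if "c \<in> set ?w" for c
    using same that by (auto simp: same_crossings_def)
  have real: "real_crossings D' = ?S"
    using data by (auto simp: real_crossings_def set)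
  have T: "?T \<subseteq> set ?w" using sets by (auto simp: w doubleton_eq_iff)
  have 2: "count_list ?w c = 2" "count_list ?w' c = 2" if "c \<in> set ?w" for c
    using that set by (auto intro: count_word)
  let ?K = "{m1, m1 + 1, m2, m2 + 1, m3, m3 + 1}"
  have K: "?w ! p \<in> ?T" if "p \<in> ?K" for p
    using that sets by (auto simp: w m nth_append doubleton_eq_iff)
  have w'_nth: "?w' ! p = ?w ! p" if "p \<notin> ?K" for p
    using that by (auto simp: w m nth_append nth_Cons')
  have far: "passage ?w c u \<notin> ?K" "passage ?w' c u = passage ?w c u"
    if c: "c \<in> set ?w" "c \<notin> ?T" for c u
  proof -
    have notK: "passage ?w c u \<notin> ?K" for u
      using K[of "passage ?w c u"] passage_nth(2)[OF 2(1)[OF c(1)], of u] c(2) by (auto simp only:)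
    then show "passage ?w c u \<notin> ?K" .
    have "length ?w' = length ?w" by (simp add: w)
    then have "passage ?w' c u = (if u then passage ?w c True else passage ?w c False)"
      using passage_nth[OF 2(1)[OF c(1)]] occurrences_twice(2)[OF 2(1)[OF c(1)]]
      by (intro passage_eqI' 2(2) c) (simp_all add: w'_nth[OF notK])
    then show "passage ?w' c u = passage ?w c u" by simp
  qed
\<comment> \<open>Exchanges happen within adjacent pairs only, so nothing else changes its relative position.\<close>

  have same_side: "sgn (int (passage ?w' c u) - int n) = sgn (int (passage ?w c u) - int n)"
    if c: "c \<in> set ?w" and n: "n \<notin> ?K" for c u n
  proof (cases "c \<in> ?T")
    case True
    have near: "sgn (int (m + of_bool x) - int n) = sgn (int (m + of_bool y) - int n)"
      if "n \<noteq> m" "n \<noteq> m + 1" for x y m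
      using that by (cases x; cases y) (auto simp: sgn_if)
    show ?thesis
      using True n near by (cases u) (auto simp: P P' simp del: of_bool_not_iff)
  next
    case False
    then show ?thesis using far(2)[OF c] by simp
  qed
  have same_side': "sgn (int n - int (passage ?w' c u)) = sgn (int n - int (passage ?w c u))"
    if c: "c \<in> set ?w" and n: "n \<notin> ?K" for c u n
    using same_side[OF that, of u] by (metis minus_diff_eq sgn_minus)
  have side: "arc_side ?w' c e u = arc_side ?w c e u"
    if "c \<in> set ?w" "e \<in> set ?w" and far': "c = e \<or> c \<notin> ?T \<or> e \<notin> ?T" for c e u
  proof -
    from far' consider "c = e" | "c \<notin> ?T" | "e \<notin> ?T" by blast
    then show ?thesis
    proof cases
      case 1
      then show ?thesis using that by (simp add: arc_side_self 2)
    next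
      case 2
      show ?thesis
        unfolding arc_side_def far(2)[OF that(1) 2]
        by (simp only: same_side[OF that(2) far(1)[OF that(1) 2]] same_side'[OF that(2) far(1)[OF that(1) 2]])
    next
      case 3
      show ?thesis
        unfolding arc_side_def far(2)[OF that(2) 3]
        by (simp only: same_side[OF that(1) far(1)[OF that(2) 3]] same_side'[OF that(1) far(1)[OF that(2) 3]])
    qed
  qed
  have S: "c \<in> set ?w" if "c \<in> ?S" for c using that real_crossings_subset by blast
  show ?thesis
  proof (cases "?T \<subseteq> ?S")
    case False
    then have few: "c = e \<or> c \<notin> ?T \<or> e \<notin> ?T" if "c \<in> ?S" "e \<in> ?S" for c e
      using third_move_real_cases[OF kinds] T that by (auto simp: real_crossings_def)
    show ?thesis
      by (rule double_sum_same_crossings) (use real data S side few in auto)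
  next
    case True
    have tri': "triangle ?w (rot D) (Suc m1) (Suc m2) (Suc m3)"
      using tri by (simp add: m numeral_3_eq_3 eval_nat_numeral)
    have lt': "Suc m1 < m2" "Suc m2 < m3" "Suc m3 < length ?w" using lt by simp_all
    have r: "rot D c \<in> {1, - 1}" if "c \<in> ?T" for c
      using that T by (intro rot_sign) blast
    have nth: "?w ! passage ?w c u = c" if "c \<in> ?T" for c u
      using that T by (intro passage_nth(2) 2(1)) blast
    note signs = triangle_signs[where w = ?w and r = "rot D", OF tri' lt' r P nth]
    have triangle_flip: "triangle_flip (plus_minus o1) (plus_minus o2) (plus_minus o3) (triangle_values_of c12 c13 c23 (arc_side ?w i))
        (triangle_values_of c12 c13 c23 (arc_side ?w' i))" if i: "i \<in> ?S" for i
    proof (cases "i \<in> ?T")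
      case True
      note v = triple_sides[OF P lt(1,2)] and v' = triple_sides[OF P' lt(1,2)]
      have plus_minus_not: "plus_minus (\<not> b) = - plus_minus b" for b by (simp add: plus_minus_def)
      consider "i = c12" | "i = c13" | "i = c23" using True by blast
      then show ?thesis
      proof cases
        case 1
        show ?thesis
          unfolding 1 triangle_values_of_def v using v' triangle_flip.arc12[of "plus_minus o1" "plus_minus o2" "plus_minus o3"]
          by (simp add: plus_minus_not)
      next
        case 2
        show ?thesis
          unfolding 2 triangle_values_of_def v using v' triangle_flip.arc13[of "plus_minus o1" "plus_minus o2" "plus_minus o3"]
          by (simp add: plus_minus_not)
      next
        case 3
        show ?thesis
          unfolding 3 triangle_values_of_def v using v' triangle_flip.arc23[of "plus_minus o1" "plus_minus o2" "plus_minus o3"]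
          by (simp add: plus_minus_not)
      qed
    next
      case False
      note nK = far(1)[OF S[OF i] False]
      have near: "sgn (int (m + of_bool x) - int n) = sgn (int (m + of_bool y) - int n)"
        "sgn (int n - int (m + of_bool x)) = sgn (int n - int (m + of_bool y))"
        if "n \<noteq> m" "n \<noteq> m + 1" for x y m n
        using that by (cases x; cases y; auto simp: sgn_if)+
      have const: "arc_side ?w i c13 False = arc_side ?w i c12 False"
        "arc_side ?w i c23 False = arc_side ?w i c12 True"
        "arc_side ?w i c23 True = arc_side ?w i c13 True"
        unfolding arc_side_def P using nK[of True] nK[of False]
        by (intro arg_cong2[where f = "(+)"] near; simp)+
      have "arc_side ?w' i e u = arc_side ?w i e u" if "e \<in> ?T" for e u
        using that T S[OF i] False by (intro side) auto
      then show ?thesis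
        unfolding triangle_values_of_def by (simp add: const triangle_flip.far)
    qed
    have const: "triangle_flip (plus_minus o1) (plus_minus o2) (plus_minus o3) (triangle_values_of c12 c13 c23 (\<lambda>_ _. 2))
        (triangle_values_of c12 c13 c23 (\<lambda>_ _. 2))"
      unfolding triangle_values_of_def by (rule triangle_flip.far)
    have split: "pairing r ?S x y = pairing r ?T x y + pairing r (?S - ?T) x y" for r x y
      unfolding pairing_def using sum.subset_diff[OF True finite_real_crossings]
      by (simp add: add.commute)
    have rest: "pairing (rot D') (?S - ?T) x' y' = pairing (rot D) (?S - ?T) x y"
      if "\<And>e u. e \<in> ?S - ?T \<Longrightarrow> x' e u = x e u" "\<And>e u. e \<in> ?S - ?T \<Longrightarrow> y' e u = y e u" for x x' y y'
      using that S data by (intro pairing_cong) auto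
    have rotT: "pairing (rot D') ?T x y = pairing (rot D) ?T x y" for x y
      using T data by (intro pairing_cong) auto
    have side_rest: "arc_side ?w' i e u = arc_side ?w i e u" if "i \<in> ?S" "e \<in> ?S - ?T" for i e u
      using that S by (intro side) auto
    have "arc_pairing D' i j = arc_pairing D i j" if "i \<in> ?S" "j \<in> ?S" for i j
    proof -
      have "pairing (rot D) ?T (arc_side ?w i) (arc_side ?w j)
          = pairing (rot D) ?T (arc_side ?w' i) (arc_side ?w' j)"
        by (rule pairing_triangle_flip[OF triangle_flip[OF that(1)] triangle_flip[OF that(2)] signs distinct])
      moreover have "pairing (rot D') (?S - ?T) (arc_side ?w' i) (arc_side ?w' j)
          = pairing (rot D) (?S - ?T) (arc_side ?w i) (arc_side ?w j)"
        using that by (intro rest side_rest)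
      ultimately show ?thesis unfolding arc_pairing_def real split by (simp only: rotT)
    qed
    moreover have "arc_index D' i = arc_index D i" if "i \<in> ?S" for i
    proof -
      have "pairing (rot D) ?T (arc_side ?w i) (\<lambda>_ _. 2) = pairing (rot D) ?T (arc_side ?w' i) (\<lambda>_ _. 2)"
        by (rule pairing_triangle_flip[OF triangle_flip[OF that] const signs distinct])
      moreover have "pairing (rot D') (?S - ?T) (arc_side ?w' i) (\<lambda>_ _. 2)
          = pairing (rot D) (?S - ?T) (arc_side ?w i) (\<lambda>_ _. 2)"
        using that by (intro rest side_rest refl)
      ultimately show ?thesis unfolding arc_index_def real split by (simp only: rotT)
    qed
    moreover have "crossings_of_type D' a = crossings_of_type D a" for a
      using data S by (auto simp: crossings_of_type_def real crossing_type_def)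
    moreover have "crossing_sign D' i = crossing_sign D i" if "i \<in> ?S" for i
      using data[OF S[OF that]] by (simp add: crossing_sign_def)
    ultimately show ?thesis
      unfolding double_sum_def by (simp add: crossings_of_type_real)
  qed
qed

section \<open>A planar family\<close>

text \<open>
  A row of \<open>2n + 1\<close> crossings between two parallel strands, closed up as for the torus knot
  \<open>T(2, 2n + 1)\<close>. The number of crossings is odd so that the closure is a single curve. Along the
  row the orientations of the tangent frames alternate, as the curve is planar.
\<close>

definition twist_word :: "nat \<Rightarrow> nat list" where
  "twist_word n = [0..<2 * n + 1] @ [0..<2 * n + 1]"

definition twist_rot :: "nat \<Rightarrow> int" where
  "twist_rot k = (if even k then 1 else - 1)"

lemma length_twist_word [simp]: "length (twist_word n) = 2 * (2 * n + 1)"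
  by (simp add: twist_word_def)

lemma set_twist_word [simp]: "set (twist_word n) = {..<2 * n + 1}"
  by (auto simp: twist_word_def)

lemma twist_nth:
  assumes "k < 2 * n + 1"
  shows "twist_word n ! k = k" "twist_word n ! (2 * n + 1 + k) = k"
  using assms by (simp_all add: twist_word_def nth_append del: upt_Suc)

lemma occurrences_twist:
  assumes "k < 2 * n + 1"
  shows "occurrences (twist_word n) k = {k, 2 * n + 1 + k}"
proof -
  have "i = k \<or> i = 2 * n + 1 + k" if i: "i < 2 * (2 * n + 1)" "twist_word n ! i = k" for i
  proof (cases "i < 2 * n + 1")
    case True
    then show ?thesis using i twist_nth(1) by simp
  next
    case False
    then obtain l where "i = 2 * n + 1 + l" by (metis add_diff_inverse_nat)
    then show ?thesis using i twist_nth(2)[of l n] by simp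
  qed
  then show ?thesis
    using assms twist_nth[OF assms] by (auto simp: occurrences_def)
qed

lemma count_twist: "k < 2 * n + 1 \<Longrightarrow> count_list (twist_word n) k = 2"
  by (simp add: card_occurrences[symmetric] occurrences_twist del: One_nat_def)

lemma passage_twist:
  assumes "k < 2 * n + 1"
  shows "passage (twist_word n) k u = (if u then 2 * n + 1 + k else k)"
  by (rule passage_eqI[OF occurrences_twist[OF assms]]) simp

abbreviation turn_twist :: "nat \<Rightarrow> nat \<times> bool \<Rightarrow> nat \<times> bool" where
  "turn_twist n \<equiv> next_dart (twist_word n) twist_rot"

text \<open>
  All turns, by the parity of the crossing: on the two runs through the row, edge \<open>k\<close> and edge
  \<open>M + k\<close> end at crossing \<open>k\<close>.
\<close>

lemma turn_twist:
  fixes n :: nat defines "M \<equiv> 2 * n + 1"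
  shows "\<lbrakk>k < M; even k\<rbrakk> \<Longrightarrow> turn_twist n (k, True) = (M + k + 1, True)"
    and "\<lbrakk>k < M; odd k\<rbrakk> \<Longrightarrow> turn_twist n (k, True) = (M + k, False)"
    and "\<lbrakk>k < M; even k\<rbrakk> \<Longrightarrow> turn_twist n (M + k, True) = (k, False)"
    and "\<lbrakk>k < M; odd k\<rbrakk> \<Longrightarrow> turn_twist n (M + k, True) = (k + 1, True)"
    and "turn_twist n (M + M, True) = (0, True)"
    and "turn_twist n (0, False) = (M + M, False)"
    and "\<lbrakk>k < M; odd k\<rbrakk> \<Longrightarrow> turn_twist n (k + 1, False) = (M + k + 1, True)"
    and "\<lbrakk>k < M; even k\<rbrakk> \<Longrightarrow> turn_twist n (k + 1, False) = (M + k, False)"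
    and "\<lbrakk>k < M; even k\<rbrakk> \<Longrightarrow> turn_twist n (M + k + 1, False) = (k + 1, True)"
    and "\<lbrakk>k < M; odd k\<rbrakk> \<Longrightarrow> turn_twist n (M + k + 1, False) = (k, False)"
proof -
  let ?w = "twist_word n"
  have pos: "first_pos ?w k = k" "second_pos ?w k = M + k" if "k < M" for k
    using passage_twist[of k n False] passage_twist[of k n True] that
    by (simp_all add: passage_def M_def)
  have nth: "?w ! k = k" "?w ! (M + k) = k" if "k < M" for k
    using twist_nth[of k n] that by (simp_all add: M_def)
  have M: "0 < M" "length ?w = M + M" by (simp_all add: M_def)
  have dir: "crossing_dir ?w twist_rot k = twist_rot k" "crossing_dir ?w twist_rot (M + k) = - twist_rot k"
    if "k < M" for k
    using M(1) that by (simp_all add: crossing_dir_def nth pos)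
  have other: "other_pos ?w k = M + k" "other_pos ?w (M + k) = k" if "k < M" for k
    using M(1) that by (simp_all add: other_pos_def nth pos)
  have sub: "k + 1 - 1 = k" "M + k + 1 - 1 = M + k" for k by simp_all
  show "\<lbrakk>k < M; even k\<rbrakk> \<Longrightarrow> turn_twist n (k, True) = (M + k + 1, True)"
    "\<lbrakk>k < M; odd k\<rbrakk> \<Longrightarrow> turn_twist n (k, True) = (M + k, False)"
    "\<lbrakk>k < M; even k\<rbrakk> \<Longrightarrow> turn_twist n (M + k, True) = (k, False)"
    "\<lbrakk>k < M; odd k\<rbrakk> \<Longrightarrow> turn_twist n (M + k, True) = (k + 1, True)"
    "turn_twist n (M + M, True) = (0, True)"
    "turn_twist n (0, False) = (M + M, False)"
    by (simp_all add: M dir other twist_rot_def del: length_twist_word)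
  show "\<lbrakk>k < M; odd k\<rbrakk> \<Longrightarrow> turn_twist n (k + 1, False) = (M + k + 1, True)"
    "\<lbrakk>k < M; even k\<rbrakk> \<Longrightarrow> turn_twist n (k + 1, False) = (M + k, False)"
    "\<lbrakk>k < M; even k\<rbrakk> \<Longrightarrow> turn_twist n (M + k + 1, False) = (k + 1, True)"
    "\<lbrakk>k < M; odd k\<rbrakk> \<Longrightarrow> turn_twist n (M + k + 1, False) = (k, False)"
    unfolding next_dart.simps sub by (simp_all add: M dir other twist_rot_def)
qed

(* Otherwise the simplifier evaluates turns at darts with explicit positions by the general rule
   instead of using the table above. *)
declare next_dart.simps [simp del]

text \<open>
  The faces are \<open>M - 1\<close> bigons with edges \<open>k\<close> and \<open>M + k\<close> for \<open>0 < k < M\<close>, labelled \<open>k\<close>, and three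
  others, labelled \<open>0\<close>, \<open>M\<close> and \<open>M + 1\<close>. Two of these run along the whole row, one on either side,
  and the one labelled \<open>M\<close> is the triangle between the two ends of the line and the edge \<open>M\<close> that
  joins both ends of the row.
\<close>

fun face_label :: "nat \<Rightarrow> nat \<times> bool \<Rightarrow> nat" where
  "face_label M (e, True) =
     (if e < M then if even e then 0 else e
      else if e = M then M else if even (e - M) then e - M else 0)"
| "face_label M (e, False) =
     (if e = 0 \<or> e = 2 * M then M
      else if e \<le> M then if even e then e else M + 1
      else if odd (e - M) then e - M else M + 1)"

definition face_dart :: "nat \<Rightarrow> nat \<Rightarrow> nat \<times> bool" where
  "face_dart M l =
     (if l = 0 then (0, True) else if l = M then (0, False)
      else if l = M + 1 then (M, False) else (l, odd l))"

lemma dart_cases: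
  fixes M :: nat and d :: "nat \<times> bool"
  assumes "d \<in> {0..2 * M} \<times> UNIV" "0 < M"
  obtains k where "k < M" "d = (k, True)"
    | k where "k < M" "d = (M + k, True)"
    | "d = (M + M, True)"
    | "d = (0, False)"
    | k where "k < M" "d = (k + 1, False)"
    | k where "k < M" "d = (M + k + 1, False)"
proof -
  obtain e b where d: "d = (e, b)" "e \<le> 2 * M" using assms by auto
  show thesis
  proof (cases b)
    case True
    consider "e < M" | "e = M + (e - M)" "e - M < M" | "e = M + M" using d by linarith
    then show ?thesis using that(1-3) d True by cases auto
  next
    case False
    consider "e = 0" | "e = (e - 1) + 1" "e - 1 < M" | "e = M + (e - M - 1) + 1" "e - M - 1 < M"
      using d by linarith
    then show ?thesis using that(4-6) d False by cases auto
  qed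
qed

lemma face_label_turn:
  assumes "d \<in> {0..2 * (2 * n + 1)} \<times> UNIV"
  shows "face_label (2 * n + 1) (turn_twist n d) = face_label (2 * n + 1) d"
    and "turn_twist n d \<in> {0..2 * (2 * n + 1)} \<times> UNIV"
proof -
  define M where "M = 2 * n + 1"
  have "odd M" "0 < M" by (simp_all add: M_def)
  note turn = turn_twist[where n = n, folded M_def]
  have d: "d \<in> {0..2 * M} \<times> UNIV" using assms by (simp add: M_def)
  have "face_label M (turn_twist n d) = face_label M d \<and> turn_twist n d \<in> {0..2 * M} \<times> UNIV"
  proof (cases rule: dart_cases[OF d \<open>0 < M\<close>])
    case (1 k)
    then show ?thesis using \<open>odd M\<close> by (cases "even k") (auto simp: turn dest: odd_pos)
  next
    case (2 k)
    have "Suc k < M" if "odd k" using that 2(1) \<open>odd M\<close> by (metis Suc_lessI even_Suc)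
    then show ?thesis using 2 by (cases "even k") (auto simp: turn dest: odd_pos)
  next
    case 3
    then show ?thesis using \<open>odd M\<close> by (auto simp: turn)
  next
    case 4
    then show ?thesis using \<open>odd M\<close> by (auto simp: turn)
  next
    case (5 k)
    then show ?thesis using \<open>odd M\<close> turn(7,8)[of k] by (cases "even k") auto
  next
    case (6 k)
    then show ?thesis using \<open>odd M\<close> turn(9,10)[of k] by (cases "even k") auto
  qed
  then show "face_label (2 * n + 1) (turn_twist n d) = face_label (2 * n + 1) d"
    and "turn_twist n d \<in> {0..2 * (2 * n + 1)} \<times> UNIV"
    by (simp_all add: M_def)
qed

text \<open>
  Together with the invariance of labels this shows that the faces are exactly the classes of equal
  label. The two long faces are followed by induction along the row.
\<close>

lemma in_orbit_face_dart:
  assumes "d \<in> {0..2 * (2 * n + 1)} \<times> UNIV"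
  shows "d \<in> orbit (turn_twist n) (face_dart (2 * n + 1) (face_label (2 * n + 1) d))"
proof -
  define M where "M = 2 * n + 1"
  have M: "odd M" "0 < M" by (simp_all add: M_def)
  note turn = turn_twist[where n = n, folded M_def]
  let ?f = "turn_twist n"
  have step: "y \<in> orbit ?f a" if "x \<in> orbit ?f a" "?f x = y" for x y a
    using that orbit.step by metis
  have base: "y \<in> orbit ?f a" if "?f a = y" for y a
    using that orbit.base by metis
\<comment> \<open>The long face that starts with the edge 0, followed forward.\<close>

  have outer1: "(M + 2 * j + 1, True) \<in> orbit ?f (0, True)" if "2 * j < M" for j
    using that
  proof (induction j)
    case 0
    show ?case by (rule base) (use turn(1)[of 0] M in simp)
  next
    case (Suc j)
    have "(2 * j + 2, True) \<in> orbit ?f (0, True)"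
      by (rule step[OF Suc.IH]) (use Suc.prems turn(4)[of "2 * j + 1"] in simp_all)
    then show ?case
      by (rule step) (use Suc.prems turn(1)[of "2 * j + 2"] in simp)
  qed
  have outer2: "(2 * j, True) \<in> orbit ?f (0, True)" if "2 * j < M" for j
  proof (cases j)
    case 0
    have "(M + M, True) \<in> orbit ?f (0, True)" using outer1[of n] by (simp add: M_def)
    then show ?thesis by (rule step) (simp add: turn(5) 0)
  next
    case (Suc i)
    show ?thesis
      by (rule step[OF outer1[of i]]) (use that turn(4)[of "2 * i + 1"] Suc in simp_all)
  qed
\<comment> \<open>The long face that starts with the edge \<open>M\<close>, followed backward.\<close>

  have inner1: "(M + 2 * (n - j), False) \<in> orbit ?f (M, False)" if "j \<le> n" for j
    using that
  proof (induction j)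
    case 0
    show ?case by (rule base) (use turn(8)[of "2 * n"] in \<open>simp add: M_def\<close>)
  next
    case (Suc j)
    define i where "i = n - Suc j"
    have i: "n - j = Suc i" "i < n" using Suc.prems by (auto simp: i_def)
    have "(M + 2 * i + 2, False) \<in> orbit ?f (M, False)"
      using Suc.IH Suc.prems i by simp
    then have "(2 * i + 1, False) \<in> orbit ?f (M, False)"
      by (rule step) (use i turn(10)[of "2 * i + 1"] in \<open>simp add: M_def\<close>)
    then have "(M + 2 * i, False) \<in> orbit ?f (M, False)"
      by (rule step) (use i turn(8)[of "2 * i"] in \<open>simp add: M_def\<close>)
    then show ?case by (simp add: i_def)
  qed
  have inner1': "(M + 2 * i, False) \<in> orbit ?f (M, False)" if "i \<le> n" for i
    using inner1[of "n - i"] that by simp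
  have inner2: "(2 * i + 1, False) \<in> orbit ?f (M, False)" if "i < n" for i
    by (rule step[OF inner1'[of "i + 1"]]) (use that turn(10)[of "2 * i + 1"] in \<open>simp_all add: M_def\<close>)
  have end1: "(M + M, False) \<in> orbit ?f (0, False)" by (rule base) (rule turn(6))
  have end2: "(M, True) \<in> orbit ?f (0, False)"
    by (rule step[OF end1]) (use turn(9)[of "2 * n"] in \<open>simp add: M_def\<close>)
  have end3: "(0, False) \<in> orbit ?f (0, False)"
    by (rule step[OF end2]) (use turn(3)[of 0] M in simp)
  have odd1: "(M + k, False) \<in> orbit ?f (k, True)" if "k < M" "odd k" for k
    by (rule base) (use that turn(2) in simp)
  have odd2: "(k, True) \<in> orbit ?f (k, True)" if "k < M" "odd k" for k
    by (rule step[OF odd1[OF that]]) (use that turn(9)[of "k - 1"] in \<open>cases k; simp\<close>)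
  have even1: "(M + k, True) \<in> orbit ?f (k, False)" if "k < M" "even k" "0 < k" for k
    by (rule base) (use that turn(7)[of "k - 1"] in \<open>cases k; simp\<close>)
  have even2: "(k, False) \<in> orbit ?f (k, False)" if "k < M" "even k" "0 < k" for k
    by (rule step[OF even1[OF that]]) (use that turn(3)[of k] in simp)
  have d: "d \<in> {0..2 * M} \<times> UNIV" using assms by (simp add: M_def)
  have "d \<in> orbit ?f (face_dart M (face_label M d))"
  proof (cases rule: dart_cases[OF d \<open>0 < M\<close>])
    case (1 k)
    then show ?thesis
      using outer2[of "k div 2"] odd2[of k] by (cases "even k") (auto simp: face_dart_def)
  next
    case (2 k)
    then show ?thesis
      using end2 even1[of k] outer1[of "k div 2"]
      by (cases "even k") (auto simp: face_dart_def elim!: oddE)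
  next
    case 3
    then show ?thesis using outer1[of n] M by (simp add: face_dart_def M_def)
  next
    case 4
    then show ?thesis using end3 M by (simp add: face_dart_def)
  next
    case (5 k)
    show ?thesis
    proof (cases "even k")
      case True
      then obtain i where i: "k = 2 * i" by (elim evenE)
      then consider "i < n" | "i = n" using 5 unfolding M_def by linarith
      then show ?thesis using 5 i inner2[of i] inner1'[of 0] by cases (auto simp: face_dart_def M_def)
    next
      case False
      then show ?thesis using 5 even2[of "k + 1"] M by (cases "k + 1 = M") (auto simp: face_dart_def)
    qed
  next
    case (6 k)
    show ?thesis
    proof (cases "even k")
      case True
      then show ?thesis using 6 odd1[of "k + 1"] end1 M by (cases "k + 1 = M") (auto simp: face_dart_def)
    next
      case False
      then obtain i where "k = 2 * i + 1" by (elim oddE)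
      then show ?thesis using 6 inner1'[of "i + 1"] by (auto simp: face_dart_def M_def)
    qed
  qed
  then show ?thesis by (simp add: M_def)
qed

lemma card_faces_twist: "card (faces (twist_word n) twist_rot) = 2 * n + 3"
proof -
  define M where "M = 2 * n + 1"
  let ?f = "turn_twist n" and ?A = "{0..2 * M} \<times> (UNIV :: bool set)"
  have label: "face_label M x = face_label M d \<and> x \<in> ?A" if "x \<in> orbit ?f d" "d \<in> ?A" for x d
    using that
  proof (induction rule: orbit.induct)
    case base
    then show ?case using face_label_turn[of d n] by (simp add: M_def)
  next
    case (step x)
    then show ?case using face_label_turn[of x n] by (simp add: M_def)
  qed
  have dart: "face_label M (face_dart M l) = l" "face_dart M l \<in> ?A" if "l \<le> M + 1" for l
    using that by (cases "even l"; auto simp: face_dart_def M_def)+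
  have label_le: "face_label M d \<le> M + 1" if "d \<in> ?A" for d
    using that by (cases "(M, d)" rule: face_label.cases) auto
  have reach: "d \<in> orbit ?f (face_dart M (face_label M d))" if "d \<in> ?A" for d
    using in_orbit_face_dart[of d n] that by (simp add: M_def)
  have self: "face_dart M l \<in> orbit ?f (face_dart M l)" if "l \<le> M + 1" for l
    using reach[OF dart(2)[OF that]] dart(1)[OF that] by simp
  have orbit_eq: "orbit ?f d = orbit ?f (face_dart M (face_label M d))" if "d \<in> ?A" for d
  proof (rule antisym)
    show "orbit ?f d \<subseteq> orbit ?f (face_dart M (face_label M d))"
      by (intro subsetI orbit_trans[OF _ reach[OF that]])
    show "orbit ?f (face_dart M (face_label M d)) \<subseteq> orbit ?f d"
      by (intro subsetI orbit_trans[OF _ orbit_swap[OF self[OF label_le[OF that]] reach[OF that]]])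
  qed
  have "faces (twist_word n) twist_rot = (\<lambda>l. orbit ?f (face_dart M l)) ` {0..M + 1}"
  proof (intro antisym subsetI)
    fix F assume "F \<in> faces (twist_word n) twist_rot"
    then obtain d where d: "d \<in> ?A" "F = orbit ?f d" by (auto simp: faces_def M_def)
    show "F \<in> (\<lambda>l. orbit ?f (face_dart M l)) ` {0..M + 1}"
      using orbit_eq[OF d(1)] label_le[OF d(1)] d(2) by auto
  next
    fix F assume "F \<in> (\<lambda>l. orbit ?f (face_dart M l)) ` {0..M + 1}"
    then obtain l where l: "l \<le> M + 1" "F = orbit ?f (face_dart M l)" by auto
    have "{0..length (twist_word n)} = {0..2 * M}" by (simp add: M_def)
    then show "F \<in> faces (twist_word n) twist_rot"
      unfolding faces_def l(2) using dart(2)[OF l(1)] by (intro imageI) simp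
  qed
  moreover have "inj_on (\<lambda>l. orbit ?f (face_dart M l)) {0..M + 1}"
  proof (rule inj_onI)
    fix l l' assume l: "l \<in> {0..M + 1}" "l' \<in> {0..M + 1}"
      and eq: "orbit ?f (face_dart M l) = orbit ?f (face_dart M l')"
    then have "face_dart M l \<in> orbit ?f (face_dart M l')" using self[of l] by simp
    then have "face_label M (face_dart M l) = face_label M (face_dart M l')"
      using label dart(2)[of l'] l by simp
    then show "l = l'" using dart(1) l by simp
  qed
  ultimately show ?thesis by (simp add: card_image M_def)
qed

lemma euler_char_twist: "euler_char (twist_word n) twist_rot = 2"
  by (simp add: euler_char_def card_faces_twist)

text \<open>
  Every second crossing is virtual, so that the tangent frames of the real crossings, which are the
  even ones, have the same orientation. The first real crossing has type \<open>p\<close> and all others have type \<open>q\<close>.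
\<close>

definition twist_diagram :: "nat \<Rightarrow> nat \<Rightarrow> nat \<Rightarrow> long_diagram" where
  "twist_diagram n p q = Abs_long_diagram (twist_word n, twist_rot,
     \<lambda>k. if odd k then Virtual
         else if (if k = 0 then p else q) = 0 then First_Over else First_Under)"

lemma twist_diagram_data:
  shows "word (twist_diagram n p q) = twist_word n"
    and "rot (twist_diagram n p q) = twist_rot"
    and "kind (twist_diagram n p q) = (\<lambda>k. if odd k then Virtual
         else if (if k = 0 then p else q) = 0 then First_Over else First_Under)"
proof -
  have "Rep_long_diagram (twist_diagram n p q) = (twist_word n, twist_rot,
     \<lambda>k. if odd k then Virtual
         else if (if k = 0 then p else q) = 0 then First_Over else First_Under)"
    unfolding twist_diagram_def
  proof (rule Abs_long_diagram_inverse)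
    have "count_list (twist_word n) c = 2 \<and> twist_rot c \<in> {1, - 1}" if "c \<in> set (twist_word n)" for c
      using that count_twist[of c n] by (simp add: twist_rot_def)
    then show "(twist_word n, twist_rot, \<lambda>k. if odd k then Virtual
         else if (if k = 0 then p else q) = 0 then First_Over else First_Under)
      \<in> {(w, r, \<kappa>). (\<forall>c\<in>set w. count_list w c = 2 \<and> r c \<in> {1, - 1}) \<and> euler_char w r = 2}"
      by (simp only: mem_Collect_eq case_prod_conv euler_char_twist) blast
  qed
  then show "word (twist_diagram n p q) = twist_word n"
    and "rot (twist_diagram n p q) = twist_rot"
    and "kind (twist_diagram n p q) = (\<lambda>k. if odd k then Virtual
         else if (if k = 0 then p else q) = 0 then First_Over else First_Under)"
    by (simp_all add: word.rep_eq rot.rep_eq kind.rep_eq)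
qed

section \<open>Values on long virtual knots\<close>

text \<open>
  The requirement of invariance under first moves: one of the two arcs is null-homologous, and the
  remaining argument is divisible by \<open>4\<close> by \<open>arc_index_dvd\<close>.
\<close>

definition vanishes_on_trivial_arcs :: "(int \<Rightarrow> int \<Rightarrow> int \<Rightarrow> laurent) \<Rightarrow> bool" where
  "vanishes_on_trivial_arcs \<Phi> \<longleftrightarrow> (\<forall>u. 4 dvd u \<longrightarrow> \<Phi> 0 0 u = 0 \<and> \<Phi> 0 u 0 = 0)"

lemma double_sum_reidemeister:
  assumes "reidemeister D D'" and \<Phi>: "vanishes_on_trivial_arcs \<Phi>"
  shows "double_sum \<Phi> a b D' = double_sum \<Phi> a b D"
  using assms(1)
proof cases
  case (relabel f)
  then show ?thesis by (intro double_sum_relabel)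
next
  case (first A B c)
  then show ?thesis
    using \<Phi> by (intro double_sum_first_move) (auto simp: vanishes_on_trivial_arcs_def)
next
  case (second A B C c d)
  then show ?thesis by (intro double_sum_second_move)
next
  case (third A x1 x2 B y1 y2 C z1 z2 E c12 c13 c23)
  then show ?thesis by (intro double_sum_third_move)
qed

lemma double_sum_representative:
  assumes "vanishes_on_trivial_arcs \<Phi>"
  shows "double_sum \<Phi> a b (rep_long_virtual_knot (knot_of D)) = double_sum \<Phi> a b D"
proof -
  have "double_sum \<Phi> a b D' = double_sum \<Phi> a b D" if "equivclp reidemeister D D'" for D D'
    using that by induction (use double_sum_reidemeister[OF _ assms] in auto)
  moreover have "equivclp reidemeister (rep_long_virtual_knot (knot_of D)) D"
    unfolding knot_of_def by (rule Quotient3_rep_abs[OF Quotient3_long_virtual_knot]) simp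
  ultimately show ?thesis by metis
qed

lemma vanishing_terms:
  "vanishes_on_trivial_arcs F_term" "vanishes_on_trivial_arcs G_term" "vanishes_on_trivial_arcs H_term"
  by (auto simp: vanishes_on_trivial_arcs_def F_term_def G_term_def H_term_def tpow_0 dvd_neg_div)

lemma polynomial_knot_of:
  "F_poly a b (knot_of D) = double_sum F_term a b D"
  "G_poly a b (knot_of D) = double_sum G_term a b D"
  "H_poly a b (knot_of D) = double_sum H_term a b D"
  by (simp_all add: F_poly_def G_poly_def H_poly_def F_diagram_eq G_diagram_eq H_diagram_eq
      double_sum_representative vanishing_terms)

section \<open>Intersection numbers of twist diagrams\<close>

text \<open>
  The number of elements of \<open>R\<close> above \<open>i\<close> minus the number of those below \<open>i\<close>.
\<close>

definition height :: "nat set \<Rightarrow> nat \<Rightarrow> int" where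
  "height R i = (\<Sum>e\<in>R. sgn (int e - int i))"

lemma height_bound:
  assumes "finite R" "i \<in> R"
  shows "\<bar>height R i\<bar> \<le> int (card R) - 1"
proof -
  have "height R i = (\<Sum>e\<in>R - {i}. sgn (int e - int i))"
    using assms by (simp add: height_def sum.remove[of R i])
  also have "\<bar>\<dots>\<bar> \<le> (\<Sum>e\<in>R - {i}. \<bar>sgn (int e - int i)\<bar>)" by (rule sum_abs)
  also have "\<dots> \<le> (\<Sum>e\<in>R - {i}. 1)" by (intro sum_mono) (simp add: abs_sgn_eq)
  also have "\<dots> = int (card R) - 1"
    using card_Suc_Diff1[OF assms] by simp
  finally show ?thesis .
qed

lemma height_extreme:
  assumes "finite R" "i \<in> R"
  shows "(\<And>e. e \<in> R \<Longrightarrow> i \<le> e) \<Longrightarrow> height R i = int (card R) - 1"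
    and "(\<And>e. e \<in> R \<Longrightarrow> e \<le> i) \<Longrightarrow> height R i = 1 - int (card R)"
proof -
  have split: "height R i = (\<Sum>e\<in>R - {i}. sgn (int e - int i))"
    using assms by (simp add: height_def sum.remove[of R i])
  have card: "int (card (R - {i})) = int (card R) - 1"
    using card_Suc_Diff1[OF assms] by simp
  {
    assume le: "\<And>e. e \<in> R \<Longrightarrow> i \<le> e"
    have "(\<Sum>e\<in>R - {i}. sgn (int e - int i)) = (\<Sum>e\<in>R - {i}. 1)"
    proof (rule sum.cong[OF refl])
      fix e assume "e \<in> R - {i}"
      then have "i < e" using le[of e] by (simp add: order.strict_iff_order eq_commute)
      then show "sgn (int e - int i) = 1" by simp
    qed
    then show "height R i = int (card R) - 1" using card by (simp add: split)
  }
  {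
    assume le: "\<And>e. e \<in> R \<Longrightarrow> e \<le> i"
    have "(\<Sum>e\<in>R - {i}. sgn (int e - int i)) = (\<Sum>e\<in>R - {i}. - 1)"
    proof (rule sum.cong[OF refl])
      fix e assume "e \<in> R - {i}"
      then have "e < i" using le[of e] by (simp add: order.strict_iff_order)
      then show "sgn (int e - int i) = - 1" by simp
    qed
    then show "height R i = 1 - int (card R)" using card by (simp add: split)
  }
qed

lemma arc_side_twist:
  assumes "i < 2 * n + 1" "e < 2 * n + 1"
  shows "arc_side (twist_word n) i e u
    = (if u then 1 - sgn (int e - int i) else 1 + sgn (int e - int i))"
  using assms by (auto simp: arc_side_def passage_twist sgn_if)

text \<open>
  Any two chords of real crossings are interlaced with the same orientation. So \<open>\<alpha>\<^sub>i \<cdot> \<gamma>\<close>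
  counts, with sign, the crossings after and before \<open>i\<close>, and \<open>\<alpha>\<^sub>i \<cdot> \<alpha>\<^sub>j\<close> is half the difference of
  these counts. This persists after any virtualizations, with the remaining crossings.
\<close>

lemma twist_pairing:
  assumes D: "word D = twist_word n" "rot D = twist_rot"
    and even: "\<And>c. c \<in> real_crossings D \<Longrightarrow> even c"
    and i: "i \<in> real_crossings D"
  shows "arc_index D i = 4 * height (real_crossings D) i"
    and "j \<in> real_crossings D \<Longrightarrow>
      arc_pairing D i j = 2 * (height (real_crossings D) i - height (real_crossings D) j)"
proof -
  have lt: "c < 2 * n + 1" if "c \<in> real_crossings D" for c
    using that real_crossings_subset[of D] by (auto simp: D)
  note side = arc_side_twist[OF lt lt]
  show "arc_index D i = 4 * height (real_crossings D) i"
    unfolding arc_index_def pairing_def height_def sum_distrib_left D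
    by (intro sum.cong refl) (simp add: side i twist_rot_def even algebra_simps)
  show "arc_pairing D i j = 2 * (height (real_crossings D) i - height (real_crossings D) j)"
    if j: "j \<in> real_crossings D"
    unfolding arc_pairing_def pairing_def height_def sum_subtractf[symmetric] sum_distrib_left D
    by (intro sum.cong refl) (simp add: side i j twist_rot_def even algebra_simps)
qed

lemma virtualize_data:
  "word (virtualize S D) = word D" "rot (virtualize S D) = rot D"
  "kind (virtualize S D) = (\<lambda>c. if c \<in> S then Virtual else kind D c)"
  by (transfer; auto)+

lemma real_crossings_virtualize: "real_crossings (virtualize S D) = real_crossings D - S"
  by (auto simp: real_crossings_def virtualize_data)

lemma virtualize_empty: "virtualize {} D = D"
  by transfer auto

lemma real_crossings_twist: "real_crossings (twist_diagram n p q) = (*) 2 ` {..n}"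
  by (auto simp: real_crossings_def twist_diagram_data image_iff elim!: evenE)

lemma card_real_crossings_twist: "card (real_crossings (twist_diagram n p q)) = n + 1"
  by (simp add: real_crossings_twist card_image inj_on_def)

lemma lookup_double_sum_twist:
  assumes D: "word D = twist_word n" "rot D = twist_rot"
    and even: "\<And>c. c \<in> real_crossings D \<Longrightarrow> even c"
  shows "Poly_Mapping.lookup (double_sum \<Phi> a b D) k
    = (if a = 0 then 1 else - 1) * (if b = 0 then 1 else - 1)
      * (\<Sum>i\<in>crossings_of_type D a. \<Sum>j\<in>crossings_of_type D b.
          Poly_Mapping.lookup (\<Phi> (2 * (height (real_crossings D) i - height (real_crossings D) j))
            (4 * height (real_crossings D) i) (4 * height (real_crossings D) j)) k)"
proof -
  have sign: "crossing_sign D i = (if a = 0 then 1 else - 1)" if "i \<in> crossings_of_type D a" for i a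
    using that even[of i]
    by (auto simp: crossings_of_type_def crossing_type_def crossing_sign_def D twist_rot_def split: if_splits)
  show ?thesis
    unfolding double_sum_def lookup_sum lookup_of_int_times sum_distrib_left
    by (intro sum.cong refl)
      (simp only: sign twist_pairing[OF D even] crossings_of_type_real)
qed

section \<open>The extreme coefficient\<close>

text \<open>
  The coefficient of \<open>t\<^sup>n\<close> in the term of two crossings of heights \<open>h\<close> and \<open>h'\<close>.
\<close>

definition top_coefficient :: "(int \<Rightarrow> int \<Rightarrow> int \<Rightarrow> laurent) \<Rightarrow> int \<Rightarrow> int \<Rightarrow> int \<Rightarrow> int" where
  "top_coefficient \<Phi> n h h' = Poly_Mapping.lookup (\<Phi> (2 * (h - h')) (4 * h) (4 * h')) n"

lemma top_coefficients:
  shows "top_coefficient F_term n h h' = of_bool (2 * (h - h') div 4 = n) - of_bool (0 = n)"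
    and "top_coefficient G_term n h h' = of_bool ((2 * h + 2 * h') div 4 = n) - of_bool (h = n)"
    and "top_coefficient H_term n h h' = of_bool ((2 * h' - 2 * h) div 4 = n) - of_bool (h' = n)
      - of_bool (- h = n) + of_bool (0 = n)"
proof -
  have *: "4 * h - 2 * (h - h') = 2 * h + 2 * h'" "4 * h' - 4 * h + 2 * (h - h') = 2 * h' - 2 * h"
    by simp_all
  show "top_coefficient F_term n h h' = of_bool (2 * (h - h') div 4 = n) - of_bool (0 = n)"
    by (simp add: top_coefficient_def F_term_def lookup_minus lookup_tpow tpow_0[symmetric])
  show "top_coefficient G_term n h h' = of_bool ((2 * h + 2 * h') div 4 = n) - of_bool (h = n)"
    unfolding top_coefficient_def G_term_def * by (simp add: lookup_minus lookup_tpow)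
  show "top_coefficient H_term n h h' = of_bool ((2 * h' - 2 * h) div 4 = n) - of_bool (h' = n)
      - of_bool (- h = n) + of_bool (0 = n)"
    unfolding top_coefficient_def H_term_def *
    by (simp add: lookup_minus lookup_add lookup_tpow tpow_0[symmetric])
qed

text \<open>
  All exponents are heights or averages of two heights, up to signs of the heights, so they cannot exceed the maximal absolute value of a height. The constant terms do not reach
  \<open>t\<^sup>n\<close> since \<open>n\<close> is positive.
\<close>

lemma top_coefficient_below:
  assumes "\<bar>h\<bar> < n" "\<bar>h'\<bar> < n"
  shows "top_coefficient F_term n h h' = 0" "top_coefficient G_term n h h' = 0"
    "top_coefficient H_term n h h' = 0"
proof -
  have n: "0 \<noteq> n" "h \<noteq> n" "h' \<noteq> n" "- h \<noteq> n" using assms by linarith+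
  have div: "z div 4 \<noteq> n" if "z < 4 * n" for z :: int using that by auto
  have "2 * (h - h') div 4 \<noteq> n" using assms unfolding abs_less_iff by (intro div) (simp add: algebra_simps)
  then show "top_coefficient F_term n h h' = 0" using n by (simp add: top_coefficients)
  have "(2 * h + 2 * h') div 4 \<noteq> n" using assms unfolding abs_less_iff by (intro div) (simp add: algebra_simps)
  then show "top_coefficient G_term n h h' = 0" using n by (simp add: top_coefficients)
  have "(2 * h' - 2 * h) div 4 \<noteq> n" using assms unfolding abs_less_iff by (intro div) (simp add: algebra_simps)
  then show "top_coefficient H_term n h h' = 0" using n by (simp add: top_coefficients)
qed

text \<open>
  An average of two numbers that are at most \<open>n\<close> is \<open>n\<close> only if both are. So in \<open>G\<close> and \<open>H\<close> each
  positive contribution to the coefficient is compensated by a negative one.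
\<close>

lemma top_coefficient_sign:
  assumes "0 < n" "\<bar>h\<bar> \<le> n" "\<bar>h'\<bar> \<le> n"
  shows "0 \<le> 1 * top_coefficient F_term n h h'" "0 \<le> - 1 * top_coefficient G_term n h h'"
    "0 \<le> - 1 * top_coefficient H_term n h h'"
proof -
  have n: "0 \<noteq> n" using assms by linarith
  have div: "4 * n \<le> z" if "z div 4 = n" for z :: int using that by auto
  show "0 \<le> 1 * top_coefficient F_term n h h'" using n by (simp add: top_coefficients)
  have "(2 * h + 2 * h') div 4 = n \<Longrightarrow> h = n" using assms by (auto dest!: div)
  then show "0 \<le> - 1 * top_coefficient G_term n h h'" using n by (simp add: top_coefficients)
  have "(2 * h' - 2 * h) div 4 = n \<Longrightarrow> h' = n" using assms by (auto dest!: div)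
  then show "0 \<le> - 1 * top_coefficient H_term n h h'" using n by (simp add: top_coefficients)
qed

lemma top_coefficient_extreme:
  assumes "0 < n"
  shows "0 < 1 * top_coefficient F_term n n (- n)" "0 < - 1 * top_coefficient G_term n n (- n)"
    "0 < - 1 * top_coefficient H_term n (- n) n"
  using assms by (simp_all add: top_coefficients)

text \<open>
  A height is at most the number of other real crossings. Virtualizing any crossing brings this below
  \<open>n\<close>, so that only the diagram without virtualizations contributes to \<open>t\<^sup>n\<close>.
\<close>

lemma lookup_alternating_sum_twist:
  assumes v: "\<And>D. v (knot_of D) = double_sum \<Phi> a b D"
    and low: "\<And>h h'. \<lbrakk>\<bar>h\<bar> < int n; \<bar>h'\<bar> < int n\<rbrakk> \<Longrightarrow> top_coefficient \<Phi> (int n) h h' = 0"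
  shows "Poly_Mapping.lookup (alternating_sum v (twist_diagram n p q)
      (real_crossings (twist_diagram n p q))) (int n)
    = Poly_Mapping.lookup (double_sum \<Phi> a b (twist_diagram n p q)) (int n)"
proof -
  let ?D = "twist_diagram n p q"
  let ?R = "real_crossings ?D"
  have zero: "Poly_Mapping.lookup (double_sum \<Phi> a b (virtualize S ?D)) (int n) = 0"
    if S: "S \<subseteq> ?R" "S \<noteq> {}" for S
  proof -
    let ?D' = "virtualize S ?D"
    have "card (real_crossings ?D') < card ?R"
      unfolding real_crossings_virtualize using S by (intro psubset_card_mono) auto
    then have "\<bar>height (real_crossings ?D') i\<bar> < int n" if "i \<in> real_crossings ?D'" for i
      using height_bound[OF finite_real_crossings that] by (simp add: card_real_crossings_twist)
    then have "top_coefficient \<Phi> (int n) (height (real_crossings ?D') i) (height (real_crossings ?D') j) = 0"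
      if "i \<in> crossings_of_type ?D' a" "j \<in> crossings_of_type ?D' b" for i j
      using that crossings_of_type_real by (blast intro: low)
    then show ?thesis
      by (subst lookup_double_sum_twist[where n = n])
        (auto simp: virtualize_data twist_diagram_data real_crossings_virtualize real_crossings_twist
          top_coefficient_def)
  qed
  have "Poly_Mapping.lookup (alternating_sum v ?D ?R) (int n)
      = (\<Sum>S\<in>Pow ?R. (if even (card S) then 1 else - 1)
          * Poly_Mapping.lookup (double_sum \<Phi> a b (virtualize S ?D)) (int n))"
    unfolding alternating_sum_def lookup_sum by (intro sum.cong refl) (simp add: v)
  also have "\<dots> = (\<Sum>S\<in>{{}}. (if even (card S) then 1 else - 1)
          * Poly_Mapping.lookup (double_sum \<Phi> a b (virtualize S ?D)) (int n))"
    by (rule sum.mono_neutral_right) (use zero in auto)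
  finally show ?thesis by (simp add: virtualize_empty)
qed

text \<open>
  In the twist diagram the sign of a crossing is determined by its type, so all terms of the
  double sum carry the same sign factor, and coefficients of one sign cannot cancel.
\<close>

lemma not_finite_type_if_extreme_term:
  fixes p q :: nat and s :: int
  assumes v: "\<And>D. v (knot_of D) = double_sum \<Phi> a b D"
    and low: "\<And>n h h'. \<lbrakk>\<bar>h\<bar> < n; \<bar>h'\<bar> < n\<rbrakk> \<Longrightarrow> top_coefficient \<Phi> n h h' = 0"
    and sign: "\<And>n h h'. \<lbrakk>0 < n; \<bar>h\<bar> \<le> n; \<bar>h'\<bar> \<le> n\<rbrakk> \<Longrightarrow> 0 \<le> s * top_coefficient \<Phi> n h h'"
    and extreme: "\<And>n::nat. 0 < n \<Longrightarrow>
      \<exists>i\<in>crossings_of_type (twist_diagram n p q) a. \<exists>j\<in>crossings_of_type (twist_diagram n p q) b.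
        0 < s * top_coefficient \<Phi> (int n) (height ((*) 2 ` {..n}) i) (height ((*) 2 ` {..n}) j)"
  shows "\<not> finite_type v"
proof -
  let ?N = "{n. \<exists>D C. marked_diagram n D C \<and> alternating_sum v D C \<noteq> 0}"
  have "n + 1 \<in> ?N" if n: "0 < n" for n :: nat
  proof -
    let ?D = "twist_diagram n p q"
    let ?R = "real_crossings ?D"
    let ?c = "\<lambda>i j. top_coefficient \<Phi> (int n) (height ?R i) (height ?R j)"
    have bound: "\<bar>height ?R i\<bar> \<le> int n" if "i \<in> crossings_of_type ?D a" for i a
      using height_bound[OF finite_real_crossings crossings_of_type_real[OF that]]
      by (simp add: card_real_crossings_twist)
    have nonneg: "0 \<le> s * ?c i j"
      if "i \<in> crossings_of_type ?D a" "j \<in> crossings_of_type ?D b" for i j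
      using \<open>0 < n\<close> that by (intro sign bound) auto
    obtain i j where ij: "i \<in> crossings_of_type ?D a" "j \<in> crossings_of_type ?D b" "0 < s * ?c i j"
      using extreme[OF n] unfolding real_crossings_twist by blast
    have "0 < (\<Sum>j\<in>crossings_of_type ?D b. s * ?c i j)"
      using nonneg[OF ij(1)] by (rule sum_pos2[where f = "\<lambda>j. s * ?c i j", OF finite_crossings_of_type ij(2,3)])
    then have "0 < (\<Sum>i\<in>crossings_of_type ?D a. \<Sum>j\<in>crossings_of_type ?D b. s * ?c i j)"
      by (rule sum_pos2[OF finite_crossings_of_type ij(1)]) (intro sum_nonneg nonneg)
    then have "(\<Sum>i\<in>crossings_of_type ?D a. \<Sum>j\<in>crossings_of_type ?D b. ?c i j) \<noteq> 0"
      by (auto simp: sum_distrib_left[symmetric])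
    then have "Poly_Mapping.lookup (double_sum \<Phi> a b ?D) (int n) \<noteq> 0"
      by (subst lookup_double_sum_twist[where n = n])
        (auto simp: twist_diagram_data real_crossings_twist top_coefficient_def)
    then have "alternating_sum v ?D ?R \<noteq> 0"
      using lookup_alternating_sum_twist[of v \<Phi> a b n p q, OF v low] by auto
    moreover have "marked_diagram (n + 1) ?D ?R"
      by (simp add: marked_diagram_def card_real_crossings_twist)
    ultimately show ?thesis by blast
  qed
  then have N: "n + 1 \<in> ?N" if "0 < n" for n using that by blast
  show ?thesis
    unfolding finite_type_def
  proof
    assume "finite ?N"
    then obtain m where "\<forall>n\<in>?N. n \<le> m" unfolding finite_nat_set_iff_bounded_le by blast
    then have "Suc m + 1 \<le> m" using N[of "Suc m"] by blast
    then show False by simp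
  qed
qed

lemma twist_ends:
  assumes "0 < n"
  shows "p \<in> {0, 1} \<Longrightarrow> 0 \<in> crossings_of_type (twist_diagram n p q) p"
    and "q \<in> {0, 1} \<Longrightarrow> 2 * n \<in> crossings_of_type (twist_diagram n p q) q"
    and "height ((*) 2 ` {..n}) 0 = int n" "height ((*) 2 ` {..n}) (2 * n) = - int n"
proof -
  show "p \<in> {0, 1} \<Longrightarrow> 0 \<in> crossings_of_type (twist_diagram n p q) p"
    "q \<in> {0, 1} \<Longrightarrow> 2 * n \<in> crossings_of_type (twist_diagram n p q) q"
    using assms by (auto simp: crossings_of_type_def real_crossings_twist crossing_type_def twist_diagram_data)
  have le: "e \<le> 2 * n" if "e \<in> (*) 2 ` {..n}" for e using that by auto
  have "card ((*) 2 ` {..n}) = n + 1" by (simp add: card_image inj_on_def)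
  then show "height ((*) 2 ` {..n}) 0 = int n" "height ((*) 2 ` {..n}) (2 * n) = - int n"
    using height_extreme(1)[of "(*) 2 ` {..n}" 0] height_extreme(2)[of "(*) 2 ` {..n}" "2 * n", OF _ _ le]
    by auto
qed

text \<open>
  For \<open>F\<close> and \<open>G\<close> the term of the first crossing (height \<open>n\<close>) and the last one (height \<open>-n\<close>) is
  extreme, so the first has to be of type \<open>a\<close> and the last of type \<open>b\<close>. For \<open>H\<close> the roles are exchanged.
\<close>

theorem theorem9p2:
  fixes a b :: nat
    and X :: "nat \<Rightarrow> nat \<Rightarrow> long_virtual_knot \<Rightarrow> laurent"
  assumes "a \<in> {0, 1}" and "b \<in> {0, 1}" and "X \<in> {F_poly, G_poly, H_poly}"
  shows "\<not> finite_type (X a b)"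
proof -
  have F: "\<not> finite_type (F_poly a b)"
  proof (rule not_finite_type_if_extreme_term[OF polynomial_knot_of(1) top_coefficient_below(1) top_coefficient_sign(1)])
    fix n :: nat assume n: "0 < n"
    show "\<exists>i\<in>crossings_of_type (twist_diagram n a b) a. \<exists>j\<in>crossings_of_type (twist_diagram n a b) b.
        0 < 1 * top_coefficient F_term (int n) (height ((*) 2 ` {..n}) i) (height ((*) 2 ` {..n}) j)"
      by (intro bexI[OF _ twist_ends(1)[OF n assms(1)]] bexI[OF _ twist_ends(2)[OF n assms(2)]],
          unfold twist_ends(3,4)[OF n]) (use n in \<open>intro top_coefficient_extreme; simp\<close>)
  qed
  have G: "\<not> finite_type (G_poly a b)"
  proof (rule not_finite_type_if_extreme_term[OF polynomial_knot_of(2) top_coefficient_below(2) top_coefficient_sign(2)])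
    fix n :: nat assume n: "0 < n"
    show "\<exists>i\<in>crossings_of_type (twist_diagram n a b) a. \<exists>j\<in>crossings_of_type (twist_diagram n a b) b.
        0 < - 1 * top_coefficient G_term (int n) (height ((*) 2 ` {..n}) i) (height ((*) 2 ` {..n}) j)"
      by (intro bexI[OF _ twist_ends(1)[OF n assms(1)]] bexI[OF _ twist_ends(2)[OF n assms(2)]],
          unfold twist_ends(3,4)[OF n]) (use n in \<open>intro top_coefficient_extreme; simp\<close>)
  qed
  have H: "\<not> finite_type (H_poly a b)"
  proof (rule not_finite_type_if_extreme_term[OF polynomial_knot_of(3) top_coefficient_below(3) top_coefficient_sign(3)])
    fix n :: nat assume n: "0 < n"
    show "\<exists>i\<in>crossings_of_type (twist_diagram n b a) a. \<exists>j\<in>crossings_of_type (twist_diagram n b a) b.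
        0 < - 1 * top_coefficient H_term (int n) (height ((*) 2 ` {..n}) i) (height ((*) 2 ` {..n}) j)"
      by (intro bexI[OF _ twist_ends(2)[OF n assms(1)]] bexI[OF _ twist_ends(1)[OF n assms(2)]],
          unfold twist_ends(3,4)[OF n]) (use n in \<open>intro top_coefficient_extreme; simp\<close>)
  qed
  show ?thesis using F G H assms(3) by auto
qed

end
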